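(* The success-number function has the formula $$\lambda_U(i)=U\sum_{j=1}^{i}\int_{\frac{1}{k}}^{1}t\cdot a(t)\binom{U-1}{j-1}(\mathbb{E}[v_t])^{U-j}(1-\mathbb{E}[v_t])^{j-1}\,dt,$$ where $$v_t(x)=\begin{cases}x, & x\ge t\\ 1, & x<t,\end{cases}\qquad \mathbb{E}[v_t]=\int_0^t a(x)\,dx+\int_t^1 x\, a(x)\,dx.$$
   Context: Honeyword system with $U$ users. Each user's sweetword list is generated independently: one real password sampled from a distribution $P$ and $k-1$ honeywords sampled i.i.d. from a distribution $Q$, then randomly shuffled. The attacker gets only one guess per account ($T_1=1$). In the success-number game with parameter $t$, an attacker $\mathcal{A}$ (any probabilistic Turing machine) receives all $U$ sweetword lists and outputs $U$ guesses $(x,pw^* )$ with distinct user indices $x\in\{1,\dots,U\}$; the guesses are checked in order, the success number increases by one if $pw^*$ is the password of user $x$ and the failure number increases by one otherwise, and the game outputs the success number when the failure number reaches $t$, or after all $U$ guesses are checked. $\lambda_U(t)$ is the maximum over attackers $\mathcal{A}$ of the expected output of this game. For user $i$ with sweetwords $sw_{i1},\dots,sw_{ik}$, let $w_i=\max_{1\le m\le k}\frac{P(sw_{im})/Q(sw_{im})}{\sum_{j=1}^{k}P(sw_{ij})/Q(sw_{ij})}$, the success probability of the optimal single guess on that account; $w$ is a random variable (randomness from generating the sweetword list) with probability density $a(t)$, $0\le t\le 1$. *)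

theory Defs
  imports "HOL-Probability.Probability" "HOL-Combinatorics.Permutations"
begin

text \<open>Randomness of one user's sweetword list: the real password pw (drawn from P),
  k-1 honeywords h 0, ..., h (k-2) (i.i.d. from Q), and a uniformly random shuffle
  sigma of the k positions.\<close>
definition user_space ::
  "'a measure \<Rightarrow> 'a measure \<Rightarrow> nat \<Rightarrow> ('a \<times> (nat \<Rightarrow> 'a) \<times> (nat \<Rightarrow> nat)) measure" where
  "user_space P Q k =
     P \<Otimes>\<^sub>M ((PiM {..<k - 1} (\<lambda>_. Q)) \<Otimes>\<^sub>M uniform_count_measure {\<sigma>. \<sigma> permutes {..<k}})"

definition sweetwords :: "nat \<Rightarrow> 'a \<times> (nat \<Rightarrow> 'a) \<times> (nat \<Rightarrow> nat) \<Rightarrow> nat \<Rightarrow> 'a" where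
  "sweetwords k u = (case u of (pw, h, \<sigma>) \<Rightarrow>
     (\<lambda>j\<in>{..<k}. if \<sigma> j = 0 then pw else h (\<sigma> j - 1)))"

definition real_pw :: "'a \<times> (nat \<Rightarrow> 'a) \<times> (nat \<Rightarrow> nat) \<Rightarrow> 'a" where
  "real_pw u = fst u"

text \<open>w = max_m (P/Q)(sw m) / sum_j (P/Q)(sw j), with f the likelihood ratio P/Q.\<close>
definition best_prob :: "('a \<Rightarrow> real) \<Rightarrow> nat \<Rightarrow> (nat \<Rightarrow> 'a) \<Rightarrow> real" where
  "best_prob f k sw = Max ((\<lambda>m. f (sw m) / (\<Sum>j<k. f (sw j))) ` {..<k})"

text \<open>Success-number game on the sequence of check results: the argument t is the
  number of failures still allowed before the game stops; the output is the number
  of successes seen when the failure number reaches t or the guesses run out.\<close>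
fun game :: "nat \<Rightarrow> bool list \<Rightarrow> nat" where
  "game 0 bs = 0"
| "game (Suc t) [] = 0"
| "game (Suc t) (b # bs) = (if b then Suc (game (Suc t) bs) else game t bs)"

definition lists_space :: "'a measure \<Rightarrow> nat \<Rightarrow> nat \<Rightarrow> (nat \<Rightarrow> nat \<Rightarrow> 'a) measure" where
  "lists_space M U k = PiM {..<U} (\<lambda>_. PiM {..<k} (\<lambda>_. M))"

text \<open>Random coins of a probabilistic attacker: one uniform real in [0,1].\<close>
definition seed_space :: "real measure" where
  "seed_space = uniform_measure lborel {0..1}"

type_synonym 'a attacker = "real \<Rightarrow> (nat \<Rightarrow> nat \<Rightarrow> 'a) \<Rightarrow> (nat \<Rightarrow> nat) \<times> (nat \<Rightarrow> 'a)"

text \<open>An attacker gets its coins r and all U sweetword lists and outputs U guesses: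
  the j-th guess is (fst (A r Ls) j, snd (A r Ls) j); user indices are distinct.\<close>
definition valid_attacker :: "'a measure \<Rightarrow> nat \<Rightarrow> nat \<Rightarrow> 'a attacker \<Rightarrow> bool" where
  "valid_attacker M U k A \<longleftrightarrow>
     (\<forall>r Ls. bij_betw (fst (A r Ls)) {..<U} {..<U}) \<and>
     (\<forall>j<U. (\<lambda>(r, Ls). fst (A r Ls) j)
               \<in> measurable (seed_space \<Otimes>\<^sub>M lists_space M U k) (count_space UNIV)) \<and>
     (\<forall>j<U. (\<lambda>(r, Ls). snd (A r Ls) j)
               \<in> measurable (seed_space \<Otimes>\<^sub>M lists_space M U k) M)"

definition game_output ::
  "nat \<Rightarrow> nat \<Rightarrow> nat \<Rightarrow> 'a attacker \<Rightarrow> real \<Rightarrow> (nat \<Rightarrow> 'a \<times> (nat \<Rightarrow> 'a) \<times> (nat \<Rightarrow> nat)) \<Rightarrow> nat" where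
  "game_output U k t A r \<omega> =
     (let Ls = (\<lambda>i\<in>{..<U}. sweetwords k (\<omega> i)); gs = A r Ls in
      game t (map (\<lambda>j. snd gs j = real_pw (\<omega> (fst gs j))) [0..<U]))"

definition success_number :: "'a measure \<Rightarrow> 'a measure \<Rightarrow> nat \<Rightarrow> nat \<Rightarrow> nat \<Rightarrow> ennreal" where
  "success_number P Q k U t =
     (SUP A \<in> {A. valid_attacker Q U k A}.
        \<integral>\<^sup>+ r. \<integral>\<^sup>+ \<omega>. of_nat (game_output U k t A r \<omega>)
              \<partial>(PiM {..<U} (\<lambda>_. user_space P Q k)) \<partial>seed_space)"

definition Ev :: "(real \<Rightarrow> real) \<Rightarrow> real \<Rightarrow> real" where
  "Ev a t = (LBINT x=0..t. a x) + (LBINT x=t..1. x * a x)"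

end

theory Submission
  imports Defs
begin

text \<open>
  Given all sweetword lists, the checks of different users are independent, and by Bayes' rule
  a guess g on a list l succeeds with probability proportional to the likelihood ratio f g.
  Averaging over the passwords therefore turns the expected output of any attacker into the
  expected output of a game with independent Bernoulli checks. This is increasing in every success
  probability, and an adjacent exchange shows that trying the more likely guesses first is optimal.
  Hence the best attacker guesses the word with the largest ratio in every list and attacks the users
  by decreasing w.

  For this attacker, a user with w = t contributes a success iff his own guess is right and fewer
  than i of the other users both have a larger w and a wrong guess. Since those users are independent
  and each is such a failure with probability 1 - E[v_t], the number of failures is binomial, and
  integrating t times the binomial distribution function against the density of w gives the formula.
\<close>

section \<open>Exchange argument for the order of the guesses\<close>

text \<open>The attacker sees all lists at once, so both the user attacked at position j and the
  word guessed there may depend on every list. No conditional expectation is formed: the coins are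
  fixed, one user is split off by Fubini, and the outcome of the check on that user is exchanged for
  its posterior. The exchange is exact because every user is checked only once, which makes the
  expected output affine in that outcome. Two kinds of ties shape the proof. Equal words within a
  list add up their ratios, so a guess could then succeed with probability above w;
  \<open>atomless\<close> makes this a null event. Equal values of w between users are broken by the
  index, which keeps the order total and measurable, and the density of w makes such ties negligible
  in the final integral. The number E[v_t] is 1 minus the integral of (1 - x) a(x) over x > t, and
  that integral is the probability that a given user both has a larger w and is guessed wrongly. The
  j-th summand of the formula is the case of exactly j - 1 such users among the other U - 1.\<close>

text \<open>Expected output of the game if the guesses succeed independently with probabilities ps.\<close>
fun expected_game :: "nat \<Rightarrow> real list \<Rightarrow> real" where
  "expected_game 0 ps = 0"
| "expected_game (Suc t) [] = 0"
| "expected_game (Suc t) (p # ps) =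
     p * (1 + expected_game (Suc t) ps) + (1 - p) * expected_game t ps"

lemma expected_game_Nil [simp]: "expected_game t [] = 0"
  by (cases t) auto

lemma expected_game_of_bool:
  "expected_game t (map of_bool bs) = real (game t bs)"
  by (induction t bs rule: game.induct) auto

lemma expected_game_nonneg:
  "set ps \<subseteq> {0..1} \<Longrightarrow> 0 \<le> expected_game t ps"
  by (induction t ps rule: expected_game.induct) auto

text \<open>One more admissible failure only prolongs the game. This makes
  \<open>1 + expected_game (Suc s) ps - expected_game s ps\<close>, the slope of the expected output
  in the probability of the first guess, nonnegative.\<close>

lemma expected_game_mono_failures:
  assumes "set ps \<subseteq> {0..1}"
  shows "expected_game t ps \<le> expected_game (Suc t) ps"
  using assms
proof (induction ps arbitrary: t)
  case (Cons p ps)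
  then have p: "0 \<le> p" "p \<le> 1" and IH: "\<And>t. expected_game t ps \<le> expected_game (Suc t) ps"
    by auto
  show ?case
  proof (cases t)
    case 0
    then show ?thesis
      using expected_game_nonneg[OF Cons.prems] by (simp del: expected_game.simps(3))
  next
    case (Suc s)
    show ?thesis
      using mult_left_mono[OF IH[of "Suc s"] p(1)] mult_left_mono[OF IH[of s], of "1 - p"] p
      by (simp add: Suc algebra_simps)
  qed
qed auto

lemma expected_game_Cons_mono:
  assumes "\<And>t. expected_game t ps \<le> expected_game t qs" "0 \<le> p" "p \<le> 1"
  shows "expected_game t (p # ps) \<le> expected_game t (p # qs)"
proof (cases t)
  case (Suc s)
  then show ?thesis
    using assms by (auto intro!: add_mono mult_left_mono)
qed auto

lemma expected_game_head_mono:
  assumes "set ps \<subseteq> {0..1}" "p \<le> q"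
  shows "expected_game t (p # ps) \<le> expected_game t (q # ps)"
proof (cases t)
  case (Suc s)
  have "0 \<le> (q - p) * (1 + expected_game (Suc s) ps - expected_game s ps)"
    using expected_game_mono_failures[OF assms(1), of s] assms(2) by (intro mult_nonneg_nonneg) auto
  then show ?thesis
    by (simp add: Suc algebra_simps)
qed auto

lemma expected_game_mono:
  assumes "\<And>v. v \<in> set vs \<Longrightarrow> 0 \<le> p v \<and> p v \<le> q v \<and> q v \<le> (1::real)"
  shows "expected_game t (map p vs) \<le> expected_game t (map q vs)"
  using assms
proof (induction vs arbitrary: t)
  case (Cons v vs)
  have "expected_game t (p v # map p vs) \<le> expected_game t (p v # map q vs)"
    using Cons by (intro expected_game_Cons_mono) force+
  also have "\<dots> \<le> expected_game t (q v # map q vs)"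
    using Cons.prems by (intro expected_game_head_mono) force+
  finally show ?case
    by simp
qed auto

text \<open>Swapping two adjacent guesses changes the expected output only if a single failure is left,
  and then the more likely guess should come first.\<close>
lemma expected_game_swap:
  assumes "q \<le> p"
  shows "expected_game t (q # p # ps) \<le> expected_game t (p # q # ps)"
proof (cases t)
  case (Suc s)
  then show ?thesis
    using assms by (cases s) (auto simp: algebra_simps)
qed auto

text \<open>The key \<open>uminus\<close> makes the order descending, and insertion carries
  \<open>p\<close> past the larger entries only, each time by an adjacent swap in the favourable
  direction. As \<open>sort_key\<close> is insertion sort, its recursion then decomposes sorting
  into such swaps.\<close>

lemma expected_game_insort:
  assumes "set (p # ps) \<subseteq> {0..1}"
  shows "expected_game t (p # ps) \<le> expected_game t (insort_key uminus p ps)"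
  using assms
proof (induction ps arbitrary: t)
  case (Cons q ps)
  show ?case
  proof (cases "- p \<le> - q")
    case False
    then have "expected_game t (p # q # ps) \<le> expected_game t (q # p # ps)"
      by (intro expected_game_swap) auto
    also have "\<dots> \<le> expected_game t (q # insort_key uminus p ps)"
      using Cons by (intro expected_game_Cons_mono) auto
    finally show ?thesis
      using False by simp
  qed auto
qed auto

lemma expected_game_sort:
  assumes "set ps \<subseteq> {0..1}"
  shows "expected_game t ps \<le> expected_game t (sort_key uminus ps)"
  using assms
proof (induction ps arbitrary: t)
  case (Cons p ps)
  have "expected_game t (p # ps) \<le> expected_game t (p # sort_key uminus ps)"
    using Cons by (intro expected_game_Cons_mono) auto
  also have "\<dots> \<le> expected_game t (insort_key uminus p (sort_key uminus ps))"
    using Cons.prems by (intro expected_game_insort) auto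
  finally show ?case
    by simp
qed auto

text \<open>Since \<open>uminus\<close> is injective, a multiset has a unique descending
  arrangement, so \<open>qs\<close> is the output of \<open>sort_key\<close>.\<close>

lemma expected_game_le_sorted:
  assumes "mset ps = mset qs" "set ps \<subseteq> {0..1}" "sorted_wrt (\<ge>) qs"
  shows "expected_game t ps \<le> expected_game t qs"
proof -
  have "sorted (map uminus qs)"
    using assms(3) by (simp add: sorted_wrt_map)
  then have "sort_key uminus ps = qs"
    using assms(1) by (intro sort_key_inj_key_eq) (auto simp: inj_on_def)
  then show ?thesis
    using expected_game_sort[OF assms(2)] by metis
qed

text \<open>In a distinct list the probability of \<open>v\<close> is used at most once, so no
  product of it with itself can arise. Consequently a random 0/1 outcome of \<open>v\<close> may be
  averaged by inserting its probability.\<close>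

lemma expected_game_affine:
  assumes "distinct vs"
  shows "expected_game t (map (y(v := c)) vs) =
    c * expected_game t (map (y(v := 1)) vs) + (1 - c) * expected_game t (map (y(v := 0)) vs)"
  using assms
proof (induction vs arbitrary: t)
  case (Cons a vs)
  show ?case
  proof (cases t)
    case (Suc s)
    show ?thesis
    proof (cases "a = v")
      case True
      then have upd: "map (y(v := d)) vs = map y vs" for d
        using Cons.prems by auto
      show ?thesis
        using True by (simp only: list.map upd Suc) simp
    next
      case False
      have "distinct vs"
        using Cons.prems by simp
      note IH = Cons.IH[OF this]
      show ?thesis
        unfolding Suc list.map expected_game.simps IH fun_upd_other[OF False] by algebra
    qed
  qed auto
qed auto

text \<open>A success counts exactly if fewer than \<open>t\<close> failures precede it. This form
  removes the stopping rule and opens the game to linearity of expectation.\<close>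

lemma game_eq_sum:
  "game t bs = (\<Sum>j<length bs. of_bool (bs ! j \<and> card {l. l < j \<and> \<not> bs ! l} < t))"
proof (induction t bs rule: game.induct)
  case (3 t b bs)
  have *: "{l. l < Suc j \<and> \<not> (b # bs) ! l} =
      (if b then {} else {0}) \<union> Suc ` {l. l < j \<and> \<not> bs ! l}" for j
    by (rule set_eqI, rename_tac l, case_tac l) auto
  have "card {l. l < Suc j \<and> \<not> (b # bs) ! l} =
      of_bool (\<not> b) + card {l. l < j \<and> \<not> bs ! l}" for j
    unfolding * by (subst card_Un_disjoint) (auto simp: card_image)
  then show ?case
    using 3 by (simp add: sum.lessThan_Suc_shift del: sum.lessThan_Suc)
qed auto

lemma measurable_expected_game:
  assumes "\<And>v. v \<in> set vs \<Longrightarrow> (\<lambda>x. p v x) \<in> borel_measurable M"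
  shows "(\<lambda>x. expected_game t (map (\<lambda>v. p v x) vs)) \<in> borel_measurable M"
  using assms
proof (induction vs arbitrary: t)
  case (Cons v vs)
  have [measurable]: "p v \<in> borel_measurable M"
      "(\<lambda>x. expected_game t (map (\<lambda>v. p v x) vs)) \<in> borel_measurable M" for t
    using Cons by auto
  show ?case
    by (cases t) auto
qed auto

section \<open>Law of a single sweetword list\<close>

text \<open>Permuting an i.i.d. sample leaves its law unchanged. Here the word in the role of the
  real password is drawn from \<open>Q\<close> as well; the passage from \<open>P\<close> to
  \<open>Q\<close> is paid for by the factor \<open>f\<close> in
  \<open>nn_integral_user\<close>.\<close>

lemma distr_shuffle_PiM:
  fixes Q :: "'a measure"
  assumes Q: "prob_space Q" and k: "0 < k" and \<sigma>: "\<sigma> permutes {..<k}"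
  shows "distr (Q \<Otimes>\<^sub>M PiM {..<k - 1} (\<lambda>_. Q)) (PiM {..<k} (\<lambda>_. Q))
      (\<lambda>(x, h). sweetwords k (x, h, \<sigma>)) = PiM {..<k} (\<lambda>_. Q)"
proof -
  interpret Q: prob_space Q by fact
  interpret product_sigma_finite "\<lambda>_::nat. Q" ..
  interpret H: prob_space "PiM {..<k - 1} (\<lambda>_::nat. Q)"
    by (rule prob_space_PiM) (rule Q)
  let ?s = "\<lambda>(x, h). sweetwords k (x, h, \<sigma>)"
  have \<sigma>_less: "\<sigma> j < k" if "j < k" for j
    using permutes_in_image[OF \<sigma>, of j] that by auto
  have s[measurable]: "?s \<in> Q \<Otimes>\<^sub>M PiM {..<k - 1} (\<lambda>_. Q) \<rightarrow>\<^sub>M PiM {..<k} (\<lambda>_. Q)"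
    unfolding sweetwords_def case_prod_beta
  proof (rule measurable_restrict, goal_cases)
    case (1 j)
    then show ?case
      using \<sigma>_less[of j] by (cases "\<sigma> j = 0") auto
  qed
  show ?thesis
  proof (rule PiM_eqI)
    fix A assume A: "\<And>i. i \<in> {..<k} \<Longrightarrow> A i \<in> sets Q"
    \<comment> \<open>Position j shows the word with number \<open>\<sigma> j\<close>, so the
      constraint on word number i comes from position \<open>inv \<sigma> i\<close>. The preimage of
      a box is therefore again a box, with permuted sides.\<close>
    let ?m = "inv \<sigma>"
    have m_less: "?m j < k" if "j < k" for j
      using permutes_in_image[OF permutes_inv[OF \<sigma>], of j] that by auto
    have vim: "?s -` Pi\<^sub>E {..<k} A \<inter> space (Q \<Otimes>\<^sub>M PiM {..<k - 1} (\<lambda>_. Q)) =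
        A (?m 0) \<times> (\<Pi>\<^sub>E l\<in>{..<k - 1}. A (?m (Suc l)))" (is "?L = ?R")
    proof (intro set_eqI iffI)
      fix z assume "z \<in> ?L"
      then obtain x h where z: "z = (x, h)" and h: "h \<in> extensional {..<k - 1}"
        and a: "\<And>j. j < k \<Longrightarrow> (if \<sigma> j = 0 then x else h (\<sigma> j - 1)) \<in> A j"
        by (auto simp: sweetwords_def PiE_iff space_pair_measure space_PiM)
      have "x \<in> A (?m 0)"
        using a[OF m_less[OF k]] by (simp add: permutes_inverses[OF \<sigma>])
      moreover have "h l \<in> A (?m (Suc l))" if "l < k - 1" for l
        using a[OF m_less[of "Suc l"]] that by (simp add: permutes_inverses[OF \<sigma>])
      ultimately show "z \<in> ?R"
        using h by (auto simp: z PiE_iff)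
    next
      fix z assume "z \<in> ?R"
      then obtain x h where z: "z = (x, h)" and h: "h \<in> extensional {..<k - 1}"
        and x: "x \<in> A (?m 0)" and hl: "\<And>l. l < k - 1 \<Longrightarrow> h l \<in> A (?m (Suc l))"
        by (auto simp: PiE_iff)
      have "(if \<sigma> j = 0 then x else h (\<sigma> j - 1)) \<in> A j" if "j < k" for j
      proof (cases "\<sigma> j = 0")
        case True
        then show ?thesis
          using x permutes_inverses(2)[OF \<sigma>, of j] by simp
      next
        case False
        then have "Suc (\<sigma> j - 1) = \<sigma> j" "\<sigma> j - 1 < k - 1"
          using \<sigma>_less[OF that] by auto
        then show ?thesis
          using hl[of "\<sigma> j - 1"] False permutes_inverses(2)[OF \<sigma>, of j] by simp
      qed
      moreover have "x \<in> space Q"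
        using x A[of "?m 0"] m_less[OF k] sets.sets_into_space by blast
      moreover have "h l \<in> space Q" if "l < k - 1" for l
        using hl[OF that] A[of "?m (Suc l)"] m_less[of "Suc l"] that sets.sets_into_space
        by (auto simp: subset_eq)
      ultimately show "z \<in> ?L"
        using h by (auto simp: z sweetwords_def PiE_iff space_pair_measure space_PiM)
    qed
    have "emeasure (distr (Q \<Otimes>\<^sub>M PiM {..<k - 1} (\<lambda>_. Q)) (PiM {..<k} (\<lambda>_. Q)) ?s) (Pi\<^sub>E {..<k} A)
        = emeasure (Q \<Otimes>\<^sub>M PiM {..<k - 1} (\<lambda>_. Q)) ?R"
      unfolding vim[symmetric] using A by (intro emeasure_distr s sets_PiM_I_finite) auto
    also have "\<dots> = emeasure Q (A (?m 0)) * (\<Prod>l<k - 1. emeasure Q (A (?m (Suc l))))"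
      using A m_less k by (subst H.emeasure_pair_measure_Times, simp_all add: sets_PiM_I_finite)
        (subst emeasure_PiM, auto)
    also have "\<dots> = (\<Prod>j<Suc (k - 1). emeasure Q (A (?m j)))"
      by (simp add: prod.lessThan_Suc_shift del: prod.lessThan_Suc)
    also have "\<dots> = (\<Prod>j<k. emeasure Q (A j))"
      using k prod.permute[OF permutes_inv[OF \<sigma>], of "\<lambda>j. emeasure Q (A j)"] by (simp add: o_def)
    finally show "emeasure (distr (Q \<Otimes>\<^sub>M PiM {..<k - 1} (\<lambda>_. Q)) (PiM {..<k} (\<lambda>_. Q)) ?s)
        (Pi\<^sub>E {..<k} A) = (\<Prod>j<k. emeasure Q (A j))" .
  qed auto
qed

text \<open>Each position receives the real password under the same number (k - 1)! of shuffles.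
  After passing to inverses, a permutation is split into the image m of 0 and a permutation of the
  remaining points.\<close>

lemma sum_permutes_inv_0:
  fixes c :: "nat \<Rightarrow> ennreal"
  assumes "0 < k"
  shows "(\<Sum>\<sigma> | \<sigma> permutes {..<k}. c (inv \<sigma> 0)) = of_nat (fact (k - 1)) * (\<Sum>m<k. c m)"
proof -
  have k: "{..<k} = insert 0 {1..<k}"
    using assms by auto
  have "(\<Sum>\<sigma> | \<sigma> permutes {..<k}. c (inv \<sigma> 0)) = (\<Sum>\<sigma> | \<sigma> permutes {..<k}. c (\<sigma> 0))"
    by (rule sum_permutations_inverse[symmetric])
  also have "\<dots> = (\<Sum>m\<in>insert 0 {1..<k}. \<Sum>\<sigma> | \<sigma> permutes {1..<k}. c m)"
    unfolding k by (subst sum_over_permutations_insert)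
      (auto intro!: sum.cong simp: permutes_not_in)
  also have "\<dots> = of_nat (fact (k - 1)) * (\<Sum>m<k. c m)"
    unfolding k[symmetric] by (simp add: card_permutations[of _ "k - 1"] sum_distrib_left)
  finally show ?thesis .
qed

text \<open>\<open>f\<close> is a real-valued version of the likelihood ratio dP/dQ.
  \<open>diagonal\<close> turns the comparison of a guess with a password into an event, and
  \<open>atomless\<close> makes the words of a list almost surely distinct.\<close>

locale honeywords =
  fixes P Q :: "'a measure" and f :: "'a \<Rightarrow> real" and k :: nat
  assumes prob_P: "prob_space P" and prob_Q: "prob_space Q"
    and f_meas [measurable]: "f \<in> borel_measurable Q" and f_nonneg [simp]: "0 \<le> f x"
    and P_eq: "P = density Q (\<lambda>x. ennreal (f x))"
    and atomless: "x \<in> space Q \<Longrightarrow> emeasure Q {x} = 0"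
    and diagonal: "{p \<in> space (Q \<Otimes>\<^sub>M Q). fst p = snd p} \<in> sets (Q \<Otimes>\<^sub>M Q)"
    and k_pos: "0 < k"
begin

sublocale P: prob_space P by (rule prob_P)
sublocale Q: prob_space Q by (rule prob_Q)

abbreviation "M \<equiv> user_space P Q k"
abbreviation "Qk \<equiv> PiM {..<k} (\<lambda>_. Q)"

lemma sets_P [simp, measurable_cong]: "sets P = sets Q"
  by (simp add: P_eq)

lemma space_P [simp]: "space P = space Q"
  by (simp add: P_eq)

lemma finite_shuffles: "finite {\<sigma>. \<sigma> permutes {..<k}}"
  by (simp add: finite_permutations)

sublocale S: prob_space "uniform_count_measure {\<sigma>. \<sigma> permutes {..<k}}"
  by (rule prob_space_uniform_count_measure[OF finite_shuffles]) (auto intro: permutes_id)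

sublocale H: prob_space "PiM {..<k - 1} (\<lambda>_::nat. Q)"
  by (rule prob_space_PiM) (rule prob_Q)

sublocale Qk: prob_space "Qk"
  by (rule prob_space_PiM) (rule prob_Q)

sublocale HS: pair_prob_space "PiM {..<k - 1} (\<lambda>_::nat. Q)"
  "uniform_count_measure {\<sigma>. \<sigma> permutes {..<k}}" ..

sublocale PHS: pair_prob_space P
  "PiM {..<k - 1} (\<lambda>_::nat. Q) \<Otimes>\<^sub>M uniform_count_measure {\<sigma>. \<sigma> permutes {..<k}}" ..

sublocale M: prob_space M
  unfolding user_space_def by (rule PHS.prob_space_axioms)

lemma shuffle_less: "\<sigma> permutes {..<k} \<Longrightarrow> j < k \<Longrightarrow> \<sigma> j < k"
  using permutes_in_image[of \<sigma> "{..<k}" j] by auto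

lemma measurable_real_pw [measurable]: "real_pw \<in> M \<rightarrow>\<^sub>M Q"
  unfolding real_pw_def[abs_def] user_space_def by measurable

lemma measurable_sweetwords [measurable]: "sweetwords k \<in> M \<rightarrow>\<^sub>M Qk"
proof -
  let ?S = "{\<sigma>. \<sigma> permutes {..<k}}"
  have "(\<lambda>u. (\<lambda>\<sigma> u. sweetwords k (fst u, fst (snd u), \<sigma>)) (snd (snd u)) u) \<in> M \<rightarrow>\<^sub>M Qk"
  proof (rule measurable_compose_countable'[where I = ?S and g = "\<lambda>u. snd (snd u)"
        and f = "\<lambda>\<sigma> u. sweetwords k (fst u, fst (snd u), \<sigma>)"])
    show "(\<lambda>u. snd (snd u)) \<in> M \<rightarrow>\<^sub>M count_space ?S"
      unfolding user_space_def by measurable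
    show "countable ?S"
      using finite_shuffles by (rule countable_finite)
    fix \<sigma> assume \<sigma>: "\<sigma> \<in> ?S"
    show "(\<lambda>u. sweetwords k (fst u, fst (snd u), \<sigma>)) \<in> M \<rightarrow>\<^sub>M Qk"
      unfolding sweetwords_def case_prod_beta
    proof (rule measurable_restrict, goal_cases)
      case (1 j)
      then show ?case
        using shuffle_less[of \<sigma> j] \<sigma> unfolding user_space_def
        by (cases "\<sigma> j = 0") auto
    qed
  qed
  then show ?thesis
    by simp
qed

text \<open>Bayes: relative to the honeyword-only law of the list, the list together with the position
  m of the real password has density f (l m) / k.\<close>
lemma nn_integral_user:
  assumes F[measurable]: "F \<in> borel_measurable (Qk \<Otimes>\<^sub>M Q)"
  shows "(\<integral>\<^sup>+ u. F (sweetwords k u, real_pw u) \<partial>M) =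
    (\<integral>\<^sup>+ l. (\<Sum>m<k. ennreal (f (l m) / k) * F (l, l m)) \<partial>Qk)"
proof -
  let ?S = "{\<sigma>. \<sigma> permutes {..<k}}"
  let ?H = "PiM {..<k - 1} (\<lambda>_::nat. Q)"
  define c where "c m = (\<integral>\<^sup>+ l. ennreal (f (l m)) * F (l, l m) \<partial>Qk)" for m
  have [measurable]: "(\<lambda>u. F (sweetwords k u, real_pw u)) \<in> borel_measurable M"
    by measurable
  have shuf: "(\<lambda>(x, h). sweetwords k (x, h, \<sigma>)) \<in> Q \<Otimes>\<^sub>M ?H \<rightarrow>\<^sub>M Qk"
    if "\<sigma> permutes {..<k}" for \<sigma>
    unfolding sweetwords_def case_prod_beta
  proof (rule measurable_restrict, goal_cases)
    case (1 j)
    then show ?case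
      using shuffle_less[of \<sigma> j] that by (cases "\<sigma> j = 0") auto
  qed
  \<comment> \<open>For a fixed shuffle the real password stands at position
    \<open>inv \<sigma> 0\<close>. Replacing its law \<open>P\<close> by \<open>Q\<close> costs the
    factor \<open>f\<close> at that position, after which the whole list has law
    \<open>Qk\<close>.\<close>
  have per_shuffle: "(\<integral>\<^sup>+ x. \<integral>\<^sup>+ h. F (sweetwords k (x, h, \<sigma>), x) \<partial>?H \<partial>P) = c (inv \<sigma> 0)"
    if \<sigma>: "\<sigma> permutes {..<k}" for \<sigma>
  proof -
    note [measurable] = shuf[OF \<sigma>]
    let ?m = "inv \<sigma> 0"
    have m: "?m < k"
      using k_pos permutes_in_image[OF permutes_inv[OF \<sigma>], of 0] by auto
    have sm: "sweetwords k (x, h, \<sigma>) ?m = x" for x :: 'a and h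
      using m by (simp add: sweetwords_def permutes_inverses[OF \<sigma>])
    have [measurable]: "(\<lambda>l. l ?m) \<in> Qk \<rightarrow>\<^sub>M Q"
      using m by (intro measurable_component_singleton) auto
    have F2[measurable]: "(\<lambda>(x, h). F (sweetwords k (x, h, \<sigma>), x)) \<in> borel_measurable (Q \<Otimes>\<^sub>M ?H)"
      using measurable_compose[OF measurable_Pair[OF shuf[OF \<sigma>] measurable_fst] F]
      by (simp add: case_prod_beta)
    have [measurable]: "(\<lambda>x. \<integral>\<^sup>+ h. F (sweetwords k (x, h, \<sigma>), x) \<partial>?H) \<in> borel_measurable Q"
      using H.borel_measurable_nn_integral[OF F2] by simp
    have "(\<integral>\<^sup>+ x. \<integral>\<^sup>+ h. F (sweetwords k (x, h, \<sigma>), x) \<partial>?H \<partial>P) =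
        (\<integral>\<^sup>+ x. ennreal (f x) * (\<integral>\<^sup>+ h. F (sweetwords k (x, h, \<sigma>), x) \<partial>?H) \<partial>Q)"
      unfolding P_eq by (rule nn_integral_density) measurable
    also have "\<dots> = (\<integral>\<^sup>+ x. \<integral>\<^sup>+ h. ennreal (f x) * F (sweetwords k (x, h, \<sigma>), x) \<partial>?H \<partial>Q)"
    proof (rule nn_integral_cong)
      fix x assume x: "x \<in> space Q"
      have "(\<lambda>h. F (sweetwords k (x, h, \<sigma>), x)) \<in> borel_measurable ?H"
        using measurable_compose[OF measurable_Pair1'[OF x] F2] by simp
      then show "ennreal (f x) * (\<integral>\<^sup>+ h. F (sweetwords k (x, h, \<sigma>), x) \<partial>?H) =
          (\<integral>\<^sup>+ h. ennreal (f x) * F (sweetwords k (x, h, \<sigma>), x) \<partial>?H)"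
        by (simp add: nn_integral_cmult)
    qed
    also have "\<dots> = (\<integral>\<^sup>+ z. (case z of (x, h) \<Rightarrow> ennreal (f x) * F (sweetwords k (x, h, \<sigma>), x)) \<partial>(Q \<Otimes>\<^sub>M ?H))"
    proof -
      have "(\<lambda>(x, h). ennreal (f x) * F (sweetwords k (x, h, \<sigma>), x)) \<in> borel_measurable (Q \<Otimes>\<^sub>M ?H)"
        using F2 unfolding case_prod_beta by measurable
      from H.nn_integral_fst[OF this] show ?thesis
        by simp
    qed
    also have "\<dots> = (\<integral>\<^sup>+ z. (\<lambda>l. ennreal (f (l ?m)) * F (l, l ?m)) ((\<lambda>(x, h). sweetwords k (x, h, \<sigma>)) z) \<partial>(Q \<Otimes>\<^sub>M ?H))"
      by (intro nn_integral_cong) (auto simp: sm)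
    also have "\<dots> = (\<integral>\<^sup>+ l. ennreal (f (l ?m)) * F (l, l ?m) \<partial>distr (Q \<Otimes>\<^sub>M ?H) Qk (\<lambda>(x, h). sweetwords k (x, h, \<sigma>)))"
      by (rule nn_integral_distr[symmetric]) measurable
    also have "\<dots> = c ?m"
      unfolding c_def by (subst distr_shuffle_PiM[OF prob_Q k_pos \<sigma>]) rule
    finally show ?thesis .
  qed
  have "(\<integral>\<^sup>+ u. F (sweetwords k u, real_pw u) \<partial>M) =
     (\<integral>\<^sup>+ x. \<integral>\<^sup>+ z. F (sweetwords k (x, z), x) \<partial>(?H \<Otimes>\<^sub>M uniform_count_measure ?S) \<partial>P)"
  proof -
    have "(\<lambda>u. F (sweetwords k u, real_pw u)) \<in> borel_measurable (P \<Otimes>\<^sub>M (?H \<Otimes>\<^sub>M uniform_count_measure ?S))"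
      using \<open>(\<lambda>u. F (sweetwords k u, real_pw u)) \<in> borel_measurable M\<close> by (simp add: user_space_def)
    from HS.nn_integral_fst[OF this] show ?thesis
      by (simp add: user_space_def real_pw_def)
  qed
  also have "\<dots> = (\<integral>\<^sup>+ x. \<integral>\<^sup>+ \<sigma>. \<integral>\<^sup>+ h. F (sweetwords k (x, h, \<sigma>), x) \<partial>?H \<partial>uniform_count_measure ?S \<partial>P)"
  proof (rule nn_integral_cong)
    fix x assume x: "x \<in> space P"
    have "(\<lambda>u. F (sweetwords k u, real_pw u)) \<in> borel_measurable (P \<Otimes>\<^sub>M (?H \<Otimes>\<^sub>M uniform_count_measure ?S))"
      using \<open>(\<lambda>u. F (sweetwords k u, real_pw u)) \<in> borel_measurable M\<close> by (simp add: user_space_def)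
    from measurable_compose[OF measurable_Pair1'[OF x] this]
    have "(\<lambda>z. F (sweetwords k (x, z), x)) \<in> borel_measurable (?H \<Otimes>\<^sub>M uniform_count_measure ?S)"
      by (simp add: real_pw_def)
    from HS.nn_integral_snd[OF this]
    show "(\<integral>\<^sup>+ z. F (sweetwords k (x, z), x) \<partial>(?H \<Otimes>\<^sub>M uniform_count_measure ?S)) =
       (\<integral>\<^sup>+ \<sigma>. \<integral>\<^sup>+ h. F (sweetwords k (x, h, \<sigma>), x) \<partial>?H \<partial>uniform_count_measure ?S)"
      by simp
  qed
  also have "\<dots> = (\<integral>\<^sup>+ x. (\<Sum>\<sigma>\<in>?S. ennreal (1 / fact k) * (\<integral>\<^sup>+ h. F (sweetwords k (x, h, \<sigma>), x) \<partial>?H)) \<partial>P)"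
    using finite_shuffles
    by (simp add: uniform_count_measure_def nn_integral_point_measure_finite card_permutations[of _ k])
  also have "\<dots> = (\<Sum>\<sigma>\<in>?S. ennreal (1 / fact k) * (\<integral>\<^sup>+ x. (\<integral>\<^sup>+ h. F (sweetwords k (x, h, \<sigma>), x) \<partial>?H) \<partial>P))"
  proof -
    have "(\<lambda>x. \<integral>\<^sup>+ h. F (sweetwords k (x, h, \<sigma>), x) \<partial>?H) \<in> borel_measurable P" if "\<sigma> \<in> ?S" for \<sigma>
    proof -
      have "(\<lambda>(x, h). F (sweetwords k (x, h, \<sigma>), x)) \<in> borel_measurable (Q \<Otimes>\<^sub>M ?H)"
        using measurable_compose[OF measurable_Pair[OF shuf measurable_fst] F] that
        by (simp add: case_prod_beta)
      then show ?thesis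
        using H.borel_measurable_nn_integral[of "\<lambda>x h. F (sweetwords k (x, h, \<sigma>), x)" Q] by simp
    qed
    note meas = this
    show ?thesis
      by (subst nn_integral_sum)
        (use meas in \<open>auto intro!: sum.cong nn_integral_cmult borel_measurable_times simp del: One_nat_def\<close>)
  qed
  also have "\<dots> = ennreal (1 / fact k) * (\<Sum>\<sigma>\<in>?S. c (inv \<sigma> 0))"
    by (simp add: sum_distrib_left per_shuffle del: One_nat_def)
  also have "\<dots> = ennreal (1 / fact k) * of_nat (fact (k - 1)) * (\<Sum>m<k. c m)"
    using sum_permutes_inv_0[OF k_pos, of c] by (simp add: mult.assoc)
  also have "ennreal (1 / fact k) * of_nat (fact (k - 1)) = ennreal (1 / k)"
    using k_pos fact_reduce[of k, where 'a=real]
    by (simp add: ennreal_of_nat_eq_real_of_nat ennreal_mult[symmetric])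
  also have "ennreal (1 / k) * (\<Sum>m<k. c m) =
      (\<integral>\<^sup>+ l. (\<Sum>m<k. ennreal (f (l m) / k) * F (l, l m)) \<partial>Qk)"
  proof -
    have [measurable]: "(\<lambda>l. l m) \<in> Qk \<rightarrow>\<^sub>M Q" if "m < k" for m
      using that by (intro measurable_component_singleton) auto
    have "ennreal (f (l m) / k) * F (l, l m) = ennreal (1 / k) * (ennreal (f (l m)) * F (l, l m))" for l m
      by (simp add: mult.assoc[symmetric] ennreal_mult[symmetric])
    then show ?thesis
      unfolding c_def by (simp add: nn_integral_sum nn_integral_cmult sum_distrib_left)
  qed
  finally show ?thesis .
qed

end

section \<open>Ordering users by score\<close>

text \<open>Serves to read off a component at a random index. In a product over
  \<open>{..<n}\<close> only the components below n are measurable, hence the bound on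
  \<open>g\<close>.\<close>

lemma measurable_compose_bounded:
  fixes g :: "'b \<Rightarrow> nat"
  assumes "\<And>i. i < n \<Longrightarrow> (\<lambda>x. f i x) \<in> M \<rightarrow>\<^sub>M N"
    and g: "g \<in> M \<rightarrow>\<^sub>M count_space UNIV" and "\<And>x. x \<in> space M \<Longrightarrow> g x < n"
  shows "(\<lambda>x. f (g x) x) \<in> M \<rightarrow>\<^sub>M N"
proof (rule measurable_compose_countable'[where I = "{..<n}"])
  show "g \<in> M \<rightarrow>\<^sub>M count_space {..<n}"
    using assms(3) measurable_sets[OF g] by (subst measurable_count_space_eq2) auto
qed (use assms in auto)

text \<open>Breaking ties by the index makes this a strict total order for any scores, so that
  \<open>place\<close> is a bijection without exceptional cases.\<close>

definition ahead :: "(nat \<Rightarrow> real) \<Rightarrow> nat \<Rightarrow> nat \<Rightarrow> bool" where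
  "ahead s v u \<longleftrightarrow> s u < s v \<or> s v = s u \<and> v < u"

definition place :: "nat \<Rightarrow> (nat \<Rightarrow> real) \<Rightarrow> nat \<Rightarrow> nat" where
  "place n s u = card {v. v < n \<and> ahead s v u}"

text \<open>The inverse of \<open>place n s\<close> on \<open>{..<n}\<close>. A least index of a
  counting condition depends measurably on the scores by general closure rules, which is why the
  order is not taken from a sorting function.\<close>

definition descending :: "nat \<Rightarrow> (nat \<Rightarrow> real) \<Rightarrow> nat \<Rightarrow> nat" where
  "descending n s j = (LEAST u. u < n \<and> place n s u = j)"

lemma place_mono: "ahead s v u \<Longrightarrow> v < n \<Longrightarrow> place n s v < place n s u"
  unfolding place_def by (rule psubset_card_mono) (auto simp: ahead_def)

lemma ahead_total: "u \<noteq> v \<Longrightarrow> ahead s u v \<or> ahead s v u"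
  by (auto simp: ahead_def)

lemma ahead_iff_place: "u < n \<Longrightarrow> v < n \<Longrightarrow> ahead s v u \<longleftrightarrow> place n s v < place n s u"
  using place_mono[of s v u n] place_mono[of s u v n] ahead_total[of u v s]
  by (cases "u = v") auto

lemma bij_place: "bij_betw (place n s) {..<n} {..<n}"
proof -
  have inj: "inj_on (place n s) {..<n}"
    using place_mono[of s _ _ n] ahead_total[of _ _ s]
    by (intro inj_onI) (metis lessThan_iff less_irrefl)
  have "place n s u < n" if "u < n" for u
  proof -
    have "place n s u < card {..<n}"
      unfolding place_def using that by (intro psubset_card_mono) (auto simp: ahead_def)
    then show ?thesis by simp
  qed
  then have "place n s ` {..<n} \<subseteq> {..<n}"
    by auto
  with inj show ?thesis
    by (simp add: bij_betw_def endo_inj_surj)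
qed

lemma descending_place: "u < n \<Longrightarrow> descending n s (place n s u) = u"
  unfolding descending_def using bij_place[of n s]
  by (intro Least_equality) (auto simp: bij_betw_def inj_on_def)

lemma
  assumes "j < n"
  shows place_descending: "place n s (descending n s j) = j" and descending_less: "descending n s j < n"
proof -
  have "j \<in> place n s ` {..<n}"
    using assms bij_place[of n s] by (simp add: bij_betw_def)
  then obtain u where "u < n" "place n s u = j"
    by auto
  then show "place n s (descending n s j) = j" "descending n s j < n"
    using descending_place by auto
qed

lemma bij_descending: "bij_betw (descending n s) {..<n} {..<n}"
  by (rule bij_betw_byWitness[where f' = "place n s"])
    (use bij_place[of n s] in \<open>auto simp: descending_place place_descending descending_less bij_betw_def\<close>)

lemma sorted_descending: "sorted_wrt (\<ge>) (map (\<lambda>j. s (descending n s j)) [0..<n])"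
proof -
  have "s (descending n s j) \<le> s (descending n s i)" if "i < j" "j < n" for i j
  proof -
    have "ahead s (descending n s i) (descending n s j)"
      using that by (subst ahead_iff_place[of _ n]) (auto simp: place_descending descending_less)
    then show ?thesis
      by (auto simp: ahead_def)
  qed
  then show ?thesis
    by (auto simp: sorted_wrt_iff_nth_less)
qed

lemma measurable_ahead:
  assumes v: "(\<lambda>x. s x v) \<in> borel_measurable M" and u: "(\<lambda>x. s x u) \<in> borel_measurable M"
  shows "Measurable.pred M (\<lambda>x. ahead (s x) v u)"
proof -
  have "{x \<in> space M. s x u < s x v} \<union> {x \<in> space M. s x v = s x u \<and> v < u} \<in> sets M"
    using borel_measurable_less[OF u v] borel_measurable_eq[OF v u]
    by (intro sets.Un) (cases "v < u"; simp)+
  then show ?thesis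
    unfolding ahead_def pred_def by (simp add: Un_def Collect_conj_eq[symmetric] conj_disj_distribL)
qed

lemma measurable_descending:
  assumes s: "\<And>v. v < n \<Longrightarrow> (\<lambda>x. s x v) \<in> borel_measurable M"
  shows "(\<lambda>x. descending n (s x) j) \<in> M \<rightarrow>\<^sub>M count_space UNIV"
proof -
  have "Measurable.pred M (\<lambda>x. u < n \<and> place n (s x) u = j)" for u
  proof (cases "u < n")
    case True
    have sets: "{x \<in> space M. v \<in> {v. v < n \<and> ahead (s x) v u}} \<in> sets M" for v
      using measurable_ahead[of s v M u, OF s s[OF True]] by (cases "v < n") (simp_all add: pred_def)
    have "(\<lambda>x. place n (s x) u) \<in> M \<rightarrow>\<^sub>M count_space UNIV"
      unfolding place_def by (rule measurable_card) (rule sets)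
    then show ?thesis
      using True by simp
  next
    case False
    then show ?thesis
      by simp
  qed
  then show ?thesis
    unfolding descending_def by (rule measurable_Least)
qed

text \<open>The bijection \<open>descending n s\<close> carries the failed positions before j to the
  failed users ahead of the user at j. Reindexing by users eliminates the random order; only
  pairwise comparisons of scores remain.\<close>

lemma game_descending:
  fixes s :: "nat \<Rightarrow> real"
  shows "game t (map (\<lambda>j. b (descending n s j)) [0..<n]) =
    (\<Sum>u<n. of_bool (b u \<and> card {v. v < n \<and> ahead s v u \<and> \<not> b v} < t))"
proof -
  have "game t (map (\<lambda>j. b (descending n s j)) [0..<n]) =
    (\<Sum>j<n. of_bool (b (descending n s j) \<and> card {l. l < j \<and> \<not> b (descending n s l)} < t))"
    by (subst game_eq_sum) (auto intro!: sum.cong simp: less_trans cong: conj_cong)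
  also have "\<dots> = (\<Sum>j<n. of_bool (b (descending n s j) \<and>
      card {v. v < n \<and> ahead s v (descending n s j) \<and> \<not> b v} < t))"
  proof (rule sum.cong)
    fix j assume j: "j \<in> {..<n}"
    have "bij_betw (descending n s) {l. l < j \<and> \<not> b (descending n s l)}
        {v. v < n \<and> ahead s v (descending n s j) \<and> \<not> b v}"
      using j by (intro bij_betw_byWitness[where f' = "place n s"])
        (auto simp: place_descending descending_less descending_place ahead_iff_place[of _ n])
    then show "of_bool (b (descending n s j) \<and> card {l. l < j \<and> \<not> b (descending n s l)} < t) =
        (of_bool (b (descending n s j) \<and>
      card {v. v < n \<and> ahead s v (descending n s j) \<and> \<not> b v} < t) :: nat)"
      by (simp add: bij_betw_same_card)
  qed auto
  also have "\<dots> = (\<Sum>u<n. of_bool (b u \<and> card {v. v < n \<and> ahead s v u \<and> \<not> b v} < t))"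
    by (rule sum.reindex_bij_betw[OF bij_descending])
  finally show ?thesis .
qed

section \<open>Posterior probabilities\<close>

text \<open>Conditional probability, given the sweetword list l, that the real password is g. If all
  likelihood ratios in l vanish, this is the junk value 0; that happens with probability 0.\<close>
definition posterior :: "('a \<Rightarrow> real) \<Rightarrow> nat \<Rightarrow> (nat \<Rightarrow> 'a) \<Rightarrow> 'a \<Rightarrow> real" where
  "posterior f k l g = (\<Sum>m<k. f (l m) * of_bool (l m = g)) / (\<Sum>j<k. f (l j))"

text \<open>The least maximising position, instead of an arbitrary one, makes the selected word a
  measurable function of the list.\<close>

definition best_guess :: "('a \<Rightarrow> real) \<Rightarrow> nat \<Rightarrow> (nat \<Rightarrow> 'a) \<Rightarrow> 'a" where
  "best_guess f k l = l (LEAST m. m < k \<and> (\<forall>m'<k. f (l m') \<le> f (l m)))"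

definition optimal_attacker :: "('a \<Rightarrow> real) \<Rightarrow> nat \<Rightarrow> nat \<Rightarrow> 'a attacker" where
  "optimal_attacker f U k r L = (let \<pi> = descending U (\<lambda>i. best_prob f k (L i)) in
     (\<pi>, \<lambda>j. best_guess f k (L (\<pi> j))))"

context honeywords
begin

lemma sum_f_nonneg: "0 \<le> (\<Sum>j<k. f (l j))"
  by (simp add: sum_nonneg)

lemma posterior_nonneg: "0 \<le> posterior f k l g"
  unfolding posterior_def by (intro divide_nonneg_nonneg sum_nonneg) auto

lemma posterior_le_1: "posterior f k l g \<le> 1"
proof -
  have "(\<Sum>m<k. f (l m) * of_bool (l m = g)) \<le> (\<Sum>j<k. f (l j))"
    by (intro sum_mono) auto
  then show ?thesis
    unfolding posterior_def using sum_f_nonneg[of l] by (auto simp: divide_le_eq_1)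
qed

lemma best_prob_ge: "m < k \<Longrightarrow> f (l m) / (\<Sum>j<k. f (l j)) \<le> best_prob f k l"
  unfolding best_prob_def by (intro Max_ge) auto

lemma best_prob_obtains:
  obtains m where "m < k" "best_prob f k l = f (l m) / (\<Sum>j<k. f (l j))"
proof -
  have "best_prob f k l \<in> (\<lambda>m. f (l m) / (\<Sum>j<k. f (l j))) ` {..<k}"
    unfolding best_prob_def using k_pos by (intro Max_in) auto
  then show ?thesis
    using that by auto
qed

lemma best_prob_nonneg: "0 \<le> best_prob f k l"
  by (rule best_prob_obtains[of l]) (simp add: sum_f_nonneg)

lemma best_prob_le_1: "best_prob f k l \<le> 1"
proof -
  obtain m where m: "m < k" "best_prob f k l = f (l m) / (\<Sum>j<k. f (l j))"
    by (rule best_prob_obtains)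
  moreover have "f (l m) \<le> (\<Sum>j<k. f (l j))"
    using m by (intro member_le_sum) auto
  ultimately show ?thesis
    using sum_f_nonneg[of l] by (auto simp: divide_le_eq_1)
qed

text \<open>The k normalised ratios sum to 1, so their maximum is at least their average. This is
  the origin of the lower limit of integration.\<close>

lemma best_prob_ge_inverse:
  assumes "(\<Sum>j<k. f (l j)) \<noteq> 0"
  shows "1 / k \<le> best_prob f k l"
proof -
  have "1 = (\<Sum>m<k. f (l m) / (\<Sum>j<k. f (l j)))"
    using assms by (simp add: sum_divide_distrib[symmetric])
  also have "\<dots> \<le> (\<Sum>m<k. best_prob f k l)"
    by (intro sum_mono best_prob_ge) auto
  finally show ?thesis
    using k_pos by (simp add: field_simps)
qed

text \<open>In a list of distinct words a guess collects the ratio of at most one position; a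
  repeated word would collect several and could exceed the maximum.\<close>

lemma posterior_le_best_prob:
  assumes "inj_on l {..<k}"
  shows "posterior f k l g \<le> best_prob f k l"
proof (cases "\<exists>m<k. l m = g")
  case True
  then obtain m where m: "m < k" "l m = g"
    by auto
  have "(\<Sum>j<k. f (l j) * of_bool (l j = g)) = (\<Sum>j<k. if j = m then f (l j) else 0)"
    using assms m by (intro sum.cong) (auto simp: inj_on_def)
  then show ?thesis
    using best_prob_ge[of m l] m unfolding posterior_def by (simp only:) simp
next
  case False
  then have "posterior f k l g = 0"
    by (auto simp: posterior_def intro!: disjI1 sum.neutral)
  then show ?thesis
    by (simp add: best_prob_nonneg)
qed

lemma best_index:
  defines "m \<equiv> \<lambda>l. LEAST m. m < k \<and> (\<forall>m'<k. f (l m') \<le> f (l m))"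
  shows "m l < k" "best_guess f k l = l (m l)" "m' < k \<Longrightarrow> f (l m') \<le> f (l (m l))"
proof -
  have "Max ((\<lambda>m. f (l m)) ` {..<k}) \<in> (\<lambda>m. f (l m)) ` {..<k}"
    using k_pos by (intro Max_in) auto
  then obtain n where n: "n < k" "f (l n) = Max ((\<lambda>m. f (l m)) ` {..<k})"
    by auto
  then have "n < k \<and> (\<forall>m'<k. f (l m') \<le> f (l n))"
    by auto
  then have *: "m l < k \<and> (\<forall>m'<k. f (l m') \<le> f (l (m l)))"
    unfolding m_def by (rule LeastI)
  then show "m l < k" "m' < k \<Longrightarrow> f (l m') \<le> f (l (m l))"
    by auto
  show "best_guess f k l = l (m l)"
    by (simp add: best_guess_def m_def)
qed

text \<open>The selected position alone already contributes the maximal ratio, and further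
  occurrences of its word only add to it.\<close>

lemma best_prob_le_posterior: "best_prob f k l \<le> posterior f k l (best_guess f k l)"
proof -
  let ?m = "LEAST m. m < k \<and> (\<forall>m'<k. f (l m') \<le> f (l m))"
  obtain n where n: "n < k" "best_prob f k l = f (l n) / (\<Sum>j<k. f (l j))"
    by (rule best_prob_obtains)
  have "f (l n) \<le> f (l ?m) * of_bool (l ?m = best_guess f k l)"
    using best_index(2)[of l] best_index(3)[of n l] n by simp
  also have "\<dots> \<le> (\<Sum>m<k. f (l m) * of_bool (l m = best_guess f k l))"
    using best_index(1)[of l] by (intro member_le_sum) auto
  finally show ?thesis
    unfolding n posterior_def by (intro divide_right_mono sum_f_nonneg)
qed

lemma posterior_best_guess:
  "inj_on l {..<k} \<Longrightarrow> posterior f k l (best_guess f k l) = best_prob f k l"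
  using best_prob_le_posterior posterior_le_best_prob by (intro antisym)

section \<open>Measurability of posteriors and of the optimal guess\<close>

lemma measurable_nth: "m < k \<Longrightarrow> (\<lambda>l. l m) \<in> Qk \<rightarrow>\<^sub>M Q"
  by (intro measurable_component_singleton) auto

lemma pred_eq:
  assumes [measurable]: "g \<in> N \<rightarrow>\<^sub>M Q" "h \<in> N \<rightarrow>\<^sub>M Q"
  shows "Measurable.pred N (\<lambda>x. g x = h x)"
proof -
  have "(\<lambda>x. (g x, h x)) \<in> N \<rightarrow>\<^sub>M Q \<Otimes>\<^sub>M Q"
    by measurable
  from measurable_sets[OF this diagonal]
  have "(\<lambda>x. (g x, h x)) -` {p \<in> space (Q \<Otimes>\<^sub>M Q). fst p = snd p} \<inter> space N \<in> sets N" .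
  also have "(\<lambda>x. (g x, h x)) -` {p \<in> space (Q \<Otimes>\<^sub>M Q). fst p = snd p} \<inter> space N =
      {x \<in> space N. g x = h x}"
    using measurable_space[OF assms(1)] measurable_space[OF assms(2)]
    by (auto simp: space_pair_measure)
  finally show ?thesis
    by (simp add: pred_def)
qed

lemma measurable_posterior [measurable (raw)]:
  assumes [measurable]: "l \<in> N \<rightarrow>\<^sub>M Qk" "g \<in> N \<rightarrow>\<^sub>M Q"
  shows "(\<lambda>x. posterior f k (l x) (g x)) \<in> borel_measurable N"
proof -
  have [measurable]: "(\<lambda>x. l x m) \<in> N \<rightarrow>\<^sub>M Q" if "m < k" for m
    using measurable_compose[OF assms(1) measurable_nth[OF that]] .
  have [measurable]: "Measurable.pred N (\<lambda>x. l x m = g x)" if "m < k" for m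
    using that by (intro pred_eq) auto
  show ?thesis
    unfolding posterior_def of_bool_def
    by (intro borel_measurable_divide borel_measurable_sum borel_measurable_times measurable_If) auto
qed

lemma measurable_best_prob [measurable]: "best_prob f k \<in> borel_measurable Qk"
  unfolding best_prob_def[abs_def] by (intro borel_measurable_Max) auto

lemma measurable_best_guess [measurable]: "best_guess f k \<in> Qk \<rightarrow>\<^sub>M Q"
  unfolding best_guess_def[abs_def]
proof (rule measurable_compose_bounded[where n = k and f = "\<lambda>i l. l i"
      and g = "\<lambda>l. LEAST m. m < k \<and> (\<forall>m'<k. f (l m') \<le> f (l m))"])
  have le: "Measurable.pred Qk (\<lambda>l. f (l m') \<le> f (l m))" if "m < k" "m' < k" for m m'
    using borel_measurable_le[OF measurable_compose[OF measurable_nth[OF that(2)] f_meas]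
        measurable_compose[OF measurable_nth[OF that(1)] f_meas]]
    by (simp add: pred_def)
  have "Measurable.pred Qk (\<lambda>l. m < k \<and> (\<forall>m'<k. f (l m') \<le> f (l m)))" for m
  proof (cases "m < k")
    case True
    then have eq: "(\<lambda>l. m < k \<and> (\<forall>m'<k. f (l m') \<le> f (l m))) =
        (\<lambda>l. \<forall>m'\<in>{..<k}. f (l m') \<le> f (l m))"
      by auto
    show ?thesis
      unfolding eq by (intro pred_intros_finite(3) le True) simp_all
  next
    case False
    then have eq: "(\<lambda>l. m < k \<and> (\<forall>m'<k. f (l m') \<le> f (l m))) = (\<lambda>l. False)"
      by auto
    show ?thesis
      unfolding eq by (rule measurable_const) simp
  qed
  then show "(\<lambda>l. LEAST m. m < k \<and> (\<forall>m'<k. f (l m') \<le> f (l m))) \<in> Qk \<rightarrow>\<^sub>M count_space UNIV"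
    by (rule measurable_Least)
qed (rule measurable_nth best_index(1); assumption)+

text \<open>With all coordinates but m fixed, the event \<open>l m = l m'\<close> confines
  coordinate m to a single point, which is null by \<open>atomless\<close>. Fubini and a finite
  intersection over pairs finish the argument.\<close>

lemma AE_inj: "AE l in Qk. inj_on l {..<k}"
proof -
  interpret PQ: product_sigma_finite "\<lambda>_::nat. Q" ..
  have "AE l in Qk. l m \<noteq> l m'" if m: "m < k" "m' < k" "m \<noteq> m'" for m m'
  proof -
    let ?J = "{..<k} - {m}"
    have ins: "{..<k} = insert m ?J"
      using m by auto
    define Z where "Z = {l \<in> space Qk. l m = l m'}"
    have Z: "Z \<in> sets Qk"
      using pred_eq[OF measurable_nth[OF m(1)] measurable_nth[OF m(2)]] unfolding Z_def pred_def .
    have "emeasure Qk Z = (\<integral>\<^sup>+ x. \<integral>\<^sup>+ y. indicator Z (x(m := y)) \<partial>Q \<partial>PiM ?J (\<lambda>_. Q))"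
      using PQ.product_nn_integral_insert[of ?J m "indicator Z", folded ins,
          OF _ _ borel_measurable_indicator[OF Z]]
      by (simp add: nn_integral_indicator[OF Z])
    also have "\<dots> = (\<integral>\<^sup>+ x. 0 \<partial>PiM ?J (\<lambda>_. Q))"
    proof (rule nn_integral_cong)
      fix x assume x: "x \<in> space (PiM ?J (\<lambda>_. Q))"
      then have xm: "x m' \<in> space Q"
        using m by (auto simp: space_PiM PiE_iff)
      have "Measurable.pred Q (\<lambda>y. y = x m')"
        by (intro pred_eq measurable_ident_sets measurable_const xm) (rule refl)
      moreover have "{y \<in> space Q. y = x m'} = {x m'}"
        using xm by auto
      ultimately have sing: "{x m'} \<in> sets Q"
        by (simp add: pred_def)
      have "(\<integral>\<^sup>+ y. indicator Z (x(m := y)) \<partial>Q) \<le> (\<integral>\<^sup>+ y. indicator {x m'} y \<partial>Q)"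
        using m by (intro nn_integral_mono) (auto simp: indicator_def Z_def)
      then show "(\<integral>\<^sup>+ y. indicator Z (x(m := y)) \<partial>Q) = 0"
        using sing atomless[OF xm] by simp
    qed
    finally have "Z \<in> null_sets Qk"
      using Z by (simp add: null_sets_def)
    from AE_not_in[OF this] AE_space show ?thesis
      by eventually_elim (auto simp: Z_def)
  qed
  then have "AE l in Qk. \<forall>m\<in>{..<k}. \<forall>m'\<in>{..<k} - {m}. l m \<noteq> l m'"
    by (intro AE_finite_allI) simp_all
  then show ?thesis
    by eventually_elim (auto simp: inj_on_def)
qed

text \<open>Transfers almost sure statements from i.i.d. \<open>Q\<close> lists to actual sweetword
  lists. By \<open>nn_integral_user\<close> the latter have density proportional to the sum of the
  ratios, so lists with sum 0 are negligible and may be exempted.\<close>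

lemma AE_sweetwords:
  assumes [measurable]: "Measurable.pred Qk R"
    and R: "AE l in Qk. R l \<or> (\<Sum>j<k. f (l j)) = 0"
  shows "AE u in M. R (sweetwords k u)"
proof -
  have "(\<integral>\<^sup>+ u. indicator {l. \<not> R l} (sweetwords k u) \<partial>M) =
      (\<integral>\<^sup>+ l. (\<Sum>m<k. ennreal (f (l m) / k) * indicator {l. \<not> R l} l) \<partial>Qk)"
    using nn_integral_user[of "\<lambda>(l, p). indicator {l. \<not> R l} l"] by simp
  also have "\<dots> = (\<integral>\<^sup>+ l. 0 \<partial>Qk)"
  proof (rule nn_integral_cong_AE)
    show "AE l in Qk. (\<Sum>m<k. ennreal (f (l m) / k) * indicator {l. \<not> R l} l) = 0"
      using R
    proof eventually_elim
      case (elim l)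
      then show ?case
        by (auto simp: sum_nonneg_eq_0_iff intro!: sum.neutral)
    qed
  qed
  finally have "(\<integral>\<^sup>+ u. indicator {l. \<not> R l} (sweetwords k u) \<partial>M) = 0"
    by simp
  then have "AE u in M. indicator {l. \<not> R l} (sweetwords k u) = (0::ennreal)"
    by (subst (asm) nn_integral_0_iff_AE) auto
  then show ?thesis
    by eventually_elim (auto simp: indicator_def)
qed

lemma AE_sweetwords_inj: "AE u in M. inj_on (sweetwords k u) {..<k}"
proof (rule AE_sweetwords)
  have "Measurable.pred Qk (\<lambda>l. \<forall>m\<in>{..<k}. \<forall>m'\<in>{..<k}. l m = l m' \<longrightarrow> m = m')"
  proof (intro pred_intros_finite(3) finite_lessThan)
    fix m m' assume "m \<in> {..<k}" "m' \<in> {..<k}"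
    then have "Measurable.pred Qk (\<lambda>l. l m = l m')"
      by (intro pred_eq measurable_nth) simp_all
    then show "Measurable.pred Qk (\<lambda>l. l m = l m' \<longrightarrow> m = m')"
      by (rule pred_intros_logic(4)) (rule measurable_const, simp)
  qed
  then show "Measurable.pred Qk (\<lambda>l. inj_on l {..<k})"
    unfolding inj_on_def .
  show "AE l in Qk. inj_on l {..<k} \<or> (\<Sum>j<k. f (l j)) = 0"
    using AE_inj by eventually_elim simp
qed

lemma measurable_sum_f: "(\<lambda>l. \<Sum>j<k. f (l j)) \<in> borel_measurable Qk"
  by (intro borel_measurable_sum measurable_compose[OF measurable_nth f_meas]) simp

lemma AE_sweetwords_sum: "AE u in M. (\<Sum>j<k. f (sweetwords k u j)) \<noteq> 0"
proof (rule AE_sweetwords)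
  show "Measurable.pred Qk (\<lambda>l. (\<Sum>j<k. f (l j)) \<noteq> 0)"
    using borel_measurable_neq[OF measurable_sum_f measurable_const[of 0]] unfolding pred_def by simp
qed simp

end

section \<open>Conditioning on the sweetword lists\<close>

text \<open>The index set is a parameter so that a single user can be removed from it and put back
  by a function update.\<close>

definition lists_on :: "nat \<Rightarrow> nat set \<Rightarrow> (nat \<Rightarrow> 'a \<times> (nat \<Rightarrow> 'a) \<times> (nat \<Rightarrow> nat)) \<Rightarrow> nat \<Rightarrow> nat \<Rightarrow> 'a" where
  "lists_on k J \<omega> = (\<lambda>i\<in>J. sweetwords k (\<omega> i))"

definition passwords_on :: "nat set \<Rightarrow> (nat \<Rightarrow> 'a \<times> (nat \<Rightarrow> 'a) \<times> (nat \<Rightarrow> nat)) \<Rightarrow> nat \<Rightarrow> 'a" where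
  "passwords_on J \<omega> = (\<lambda>i\<in>J. real_pw (\<omega> i))"

context honeywords
begin

abbreviation "users J \<equiv> PiM J (\<lambda>_::nat. M)"
abbreviation "listsM J \<equiv> PiM J (\<lambda>_::nat. Qk)"
abbreviation "wordsM J \<equiv> PiM J (\<lambda>_::nat. Q)"

sublocale PM: product_sigma_finite "\<lambda>_::nat. M" ..

lemma measurable_lists_on: "lists_on k J \<in> users J \<rightarrow>\<^sub>M listsM J"
  unfolding lists_on_def[abs_def]
  by (intro measurable_restrict measurable_compose[OF _ measurable_sweetwords] measurable_component_singleton)

lemma measurable_passwords_on: "passwords_on J \<in> users J \<rightarrow>\<^sub>M wordsM J"
  unfolding passwords_on_def[abs_def]
  by (intro measurable_restrict measurable_compose[OF _ measurable_real_pw] measurable_component_singleton)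

text \<open>Fubini freezes the other users and the formula of Bayes is applied to user
  \<open>v\<close> alone. The integrand keeps all lists as an argument, because the attack on
  \<open>v\<close> may depend on each of them.\<close>

lemma nn_integral_users_posterior:
  assumes v: "v < U" and \<Psi>: "\<Psi> \<in> borel_measurable (listsM {..<U} \<Otimes>\<^sub>M wordsM {..<U})"
  shows "(\<integral>\<^sup>+ \<omega>. \<Psi> (lists_on k {..<U} \<omega>, passwords_on {..<U} \<omega>) \<partial>users {..<U}) =
    (\<integral>\<^sup>+ x. \<integral>\<^sup>+ l. (\<Sum>m<k. ennreal (f (l m) / k) *
        \<Psi> ((lists_on k ({..<U} - {v}) x)(v := l), (passwords_on ({..<U} - {v}) x)(v := l m)))
      \<partial>Qk \<partial>users ({..<U} - {v}))"
proof -
  let ?J = "{..<U} - {v}"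
  have ins: "{..<U} = insert v ?J" and un: "{..<U} = ?J \<union> {v}"
    using v by auto
  have "(\<lambda>\<omega>. \<Psi> (lists_on k {..<U} \<omega>, passwords_on {..<U} \<omega>)) \<in> borel_measurable (users {..<U})"
    by (rule measurable_compose[OF measurable_Pair[OF measurable_lists_on measurable_passwords_on] \<Psi>])
  from PM.product_nn_integral_insert[of ?J v, folded ins, OF _ _ this]
  have "(\<integral>\<^sup>+ \<omega>. \<Psi> (lists_on k {..<U} \<omega>, passwords_on {..<U} \<omega>) \<partial>users {..<U}) =
    (\<integral>\<^sup>+ x. \<integral>\<^sup>+ u. \<Psi> (lists_on k {..<U} (x(v := u)), passwords_on {..<U} (x(v := u))) \<partial>M \<partial>users ?J)"
    by simp
  also have "\<dots> = (\<integral>\<^sup>+ x. \<integral>\<^sup>+ l. (\<Sum>m<k. ennreal (f (l m) / k) *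
        \<Psi> ((lists_on k ?J x)(v := l), (passwords_on ?J x)(v := l m))) \<partial>Qk \<partial>users ?J)"
  proof (rule nn_integral_cong)
    fix x assume x: "x \<in> space (users ?J)"
    let ?F = "\<lambda>z. \<Psi> ((lists_on k ?J x)(v := fst z), (passwords_on ?J x)(v := snd z))"
    have eqs: "lists_on k {..<U} (x(v := u)) = (lists_on k ?J x)(v := sweetwords k u)"
      "passwords_on {..<U} (x(v := u)) = (passwords_on ?J x)(v := real_pw u)" for u
      using v by (auto simp: lists_on_def passwords_on_def fun_eq_iff)
    have "?F \<in> borel_measurable (Qk \<Otimes>\<^sub>M Q)"
      by (intro measurable_compose[OF measurable_Pair \<Psi>] measurable_fun_upd[OF un] measurable_const
        measurable_fst measurable_snd measurable_space[OF measurable_lists_on x]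
        measurable_space[OF measurable_passwords_on x])
    from nn_integral_user[OF this]
    show "(\<integral>\<^sup>+ u. \<Psi> (lists_on k {..<U} (x(v := u)), passwords_on {..<U} (x(v := u))) \<partial>M) =
      (\<integral>\<^sup>+ l. (\<Sum>m<k. ennreal (f (l m) / k) *
        \<Psi> ((lists_on k ?J x)(v := l), (passwords_on ?J x)(v := l m))) \<partial>Qk)"
      by (simp only: eqs fst_conv snd_conv)
  qed
  finally show ?thesis .
qed

text \<open>The positions holding the word \<open>g\<close> carry the fraction
  \<open>posterior f k l g\<close> of the total weight, so averaging the affine function evaluates
  it there; with total weight 0 both sides vanish. The right side keeps its weights so that
  \<open>nn_integral_users_posterior\<close> can be applied backwards to it.\<close>

lemma expected_game_posterior:
  assumes vs: "distinct vs" and y: "\<And>i. 0 \<le> y i \<and> y i \<le> (1::real)"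
  shows "(\<Sum>m<k. ennreal (f (l m) / k) * ennreal (expected_game t (map (y(v := of_bool (g = l m))) vs))) =
    (\<Sum>m<k. ennreal (f (l m) / k) * ennreal (expected_game t (map (y(v := posterior f k l g)) vs)))"
proof -
  let ?G = "\<lambda>c. expected_game t (map (y(v := c)) vs)"
  let ?S = "\<Sum>j<k. f (l j)"
  have nonneg: "0 \<le> ?G c" if "0 \<le> c" "c \<le> 1" for c
    using that y by (intro expected_game_nonneg) auto
  note post = posterior_nonneg[of l g] posterior_le_1[of l g]
  have "(\<Sum>m<k. f (l m) * ?G (of_bool (g = l m))) =
      (\<Sum>m<k. f (l m) * of_bool (l m = g) * ?G 1 + (f (l m) - f (l m) * of_bool (l m = g)) * ?G 0)"
    by (intro sum.cong) (auto simp del: fun_upd_apply)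
  also have "\<dots> = (\<Sum>m<k. f (l m) * of_bool (l m = g)) * ?G 1 +
      (?S - (\<Sum>m<k. f (l m) * of_bool (l m = g))) * ?G 0"
    by (simp only: sum.distrib sum_distrib_right[symmetric] sum_subtractf)
  also have "(\<Sum>m<k. f (l m) * of_bool (l m = g)) = ?S * posterior f k l g"
  proof (cases "?S = 0")
    case True
    then have "f (l m) = 0" if "m < k" for m
      using that by (simp add: sum_nonneg_eq_0_iff)
    then show ?thesis
      by simp
  qed (simp add: posterior_def)
  also have "?S * posterior f k l g * ?G 1 + (?S - ?S * posterior f k l g) * ?G 0 =
      ?S * ?G (posterior f k l g)"
    unfolding expected_game_affine[OF vs, of t y v "posterior f k l g"] by algebra
  finally have "(\<Sum>m<k. f (l m) * ?G (of_bool (g = l m))) = ?S * ?G (posterior f k l g)" .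
  then have "(\<Sum>m<k. f (l m) / k * ?G (of_bool (g = l m))) = (\<Sum>m<k. f (l m) / k * ?G (posterior f k l g))"
    by (simp add: sum_divide_distrib[symmetric] sum_distrib_right[symmetric] del: fun_upd_apply)
  moreover have "(\<Sum>m<k. ennreal (f (l m) / k) * ennreal (?G (c m))) = ennreal (\<Sum>m<k. f (l m) / k * ?G (c m))"
    if "\<And>m. 0 \<le> c m \<and> c m \<le> 1" for c
  proof -
    have "ennreal (f (l m) / k) * ennreal (?G (c m)) = ennreal (f (l m) / k * ?G (c m))" for m
      using nonneg[of "c m"] that[of m] by (intro ennreal_mult[symmetric]) simp_all
    moreover have "0 \<le> f (l m) / k * ?G (c m)" for m
      using nonneg[of "c m"] that[of m] by (intro mult_nonneg_nonneg) simp_all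
    ultimately show ?thesis
      by (simp only: sum_ennreal)
  qed
  from this[of "\<lambda>m. of_bool (g = l m)"] this[of "\<lambda>m. posterior f k l g"]
  show ?thesis
    using calculation post by simp
qed

text \<open>The outcomes of the checks are replaced by their conditional probabilities one user at a
  time; each step is exact because the expected output is affine in every single outcome.\<close>
lemma nn_integral_game_posterior:
  fixes U t :: nat and \<pi> :: "nat \<Rightarrow> (nat \<Rightarrow> nat \<Rightarrow> 'a) \<Rightarrow> nat" and \<gamma> :: "nat \<Rightarrow> (nat \<Rightarrow> nat \<Rightarrow> 'a) \<Rightarrow> 'a"
  assumes \<pi>: "\<And>j. j < U \<Longrightarrow> \<pi> j \<in> listsM {..<U} \<rightarrow>\<^sub>M count_space UNIV"
    and bij: "\<And>L. bij_betw (\<lambda>j. \<pi> j L) {..<U} {..<U}"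
    and \<gamma>: "\<And>i. i < U \<Longrightarrow> \<gamma> i \<in> listsM {..<U} \<rightarrow>\<^sub>M Q"
  defines "y \<equiv> \<lambda>S (L, p) i. if i \<in> S then posterior f k (L i) (\<gamma> i L) else of_bool (\<gamma> i L = p i)"
  defines "\<Phi> \<equiv> \<lambda>S z. expected_game t (map (y S z) (map (\<lambda>j. \<pi> j (fst z)) [0..<U]))"
  shows "(\<integral>\<^sup>+ \<omega>. ennreal (\<Phi> {} (lists_on k {..<U} \<omega>, passwords_on {..<U} \<omega>)) \<partial>users {..<U}) =
    (\<integral>\<^sup>+ \<omega>. ennreal (\<Phi> {..<U} (lists_on k {..<U} \<omega>, passwords_on {..<U} \<omega>)) \<partial>users {..<U})"
proof -
  let ?N = "listsM {..<U} \<Otimes>\<^sub>M wordsM {..<U}"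
  have \<pi>_less: "\<pi> j L < U" if "j < U" for j L
    using bij_betwE[OF bij[of L]] that by auto
  have distinct: "distinct (map (\<lambda>j. \<pi> j L) [0..<U])" for L
    using bij[of L] by (simp add: distinct_map bij_betw_def atLeast0LessThan)
  have y_meas: "(\<lambda>z. y S z i) \<in> borel_measurable ?N" if i: "i < U" for S i
  proof -
    have L: "(\<lambda>z. fst z i) \<in> ?N \<rightarrow>\<^sub>M Qk"
      by (rule measurable_compose[OF measurable_fst measurable_component_singleton]) (simp add: i)
    have p: "(\<lambda>z. snd z i) \<in> ?N \<rightarrow>\<^sub>M Q"
      by (rule measurable_compose[OF measurable_snd measurable_component_singleton]) (simp add: i)
    have g: "(\<lambda>z. \<gamma> i (fst z)) \<in> ?N \<rightarrow>\<^sub>M Q"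
      by (rule measurable_compose[OF measurable_fst \<gamma>[OF i]])
    show ?thesis
    proof (cases "i \<in> S")
      case True
      have "(\<lambda>z. y S z i) = (\<lambda>z. posterior f k (fst z i) (\<gamma> i (fst z)))"
        using True by (simp add: y_def case_prod_beta)
      then show ?thesis
        using measurable_posterior[OF L g] by simp
    next
      case False
      have eq: "(\<lambda>z. y S z i) = (\<lambda>z. if \<gamma> i (fst z) = snd z i then 1 else 0)"
        using False by (simp add: y_def case_prod_beta of_bool_def)
      show ?thesis
        unfolding eq by (intro measurable_If measurable_const pred_eq[OF g p, unfolded pred_def]) simp_all
    qed
  qed
  have \<Phi>_eq: "\<Phi> S = (\<lambda>z. expected_game t (map (\<lambda>j. y S z (\<pi> j (fst z))) [0..<U]))" for S
    by (simp add: \<Phi>_def o_def)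
  have \<Phi>_meas: "\<Phi> S \<in> borel_measurable ?N" for S
    unfolding \<Phi>_eq
  proof (rule measurable_expected_game)
    fix j assume "j \<in> set [0..<U]"
    then have j: "j < U"
      by simp
    show "(\<lambda>z. y S z (\<pi> j (fst z))) \<in> borel_measurable ?N"
      by (rule measurable_compose_bounded[where f = "\<lambda>i z. y S z i" and g = "\<lambda>z. \<pi> j (fst z)" and n = U])
        (rule y_meas measurable_compose[OF measurable_fst \<pi>[OF j]] \<pi>_less[OF j]; assumption)+
  qed
  have ennreal_\<Phi>_meas: "(\<lambda>z. ennreal (\<Phi> S z)) \<in> borel_measurable ?N" for S
    by (rule measurable_compose[OF \<Phi>_meas measurable_ennreal])
  have y_range: "0 \<le> y S z i \<and> y S z i \<le> 1" for S z i
    by (simp add: y_def posterior_nonneg posterior_le_1 split: prod.split)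
  have "(\<integral>\<^sup>+ \<omega>. ennreal (\<Phi> {} (lists_on k {..<U} \<omega>, passwords_on {..<U} \<omega>)) \<partial>users {..<U}) =
    (\<integral>\<^sup>+ \<omega>. ennreal (\<Phi> S (lists_on k {..<U} \<omega>, passwords_on {..<U} \<omega>)) \<partial>users {..<U})"
    if "finite S" "S \<subseteq> {..<U}" for S
    using that
  proof (induction S rule: finite_induct)
    case (insert v S)
    then have v: "v < U"
      by simp
    \<comment> \<open>\<open>S\<close> collects the users whose outcome is already replaced. Since
      \<open>v \<notin> S\<close>, the two integrands arise from the same \<open>y S (L, p)\<close>
      by different updates at \<open>v\<close>; the password of \<open>v\<close> is the word at
      position m of its list.\<close>
    have upd: "ennreal (\<Phi> S (L, p(v := L v m))) =
        ennreal (expected_game t (map ((y S (L, p))(v := of_bool (\<gamma> v L = L v m))) (map (\<lambda>j. \<pi> j L) [0..<U])))"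
      "ennreal (\<Phi> (insert v S) (L, p(v := L v m))) =
        ennreal (expected_game t (map ((y S (L, p))(v := posterior f k (L v) (\<gamma> v L))) (map (\<lambda>j. \<pi> j L) [0..<U])))"
      for L p m
      using \<open>v \<notin> S\<close>
      by (auto simp: \<Phi>_def y_def fun_upd_def intro!: arg_cong[where f = "expected_game t"] arg_cong[where f = ennreal])
    have step: "(\<Sum>m<k. ennreal (f (l m) / k) * ennreal (\<Phi> S (L(v := l), p(v := l m)))) =
        (\<Sum>m<k. ennreal (f (l m) / k) * ennreal (\<Phi> (insert v S) (L(v := l), p(v := l m))))" for l L p
      using expected_game_posterior[where y = "y S (L(v := l), p)" and l = l and t = t and v = v
          and g = "\<gamma> v (L(v := l))", OF distinct[of "L(v := l)"] y_range]
        upd[of "L(v := l)" p] by (simp only: fun_upd_same)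
    show ?case
      using insert by (simp add: nn_integral_users_posterior[OF v ennreal_\<Phi>_meas] step)
  qed simp
  then show ?thesis
    by simp
qed

end

section \<open>The optimal attacker\<close>

lemma space_seed [simp]: "space seed_space = UNIV"
  by (simp add: seed_space_def)

lemma prob_space_seed: "prob_space seed_space"
  unfolding seed_space_def by (rule prob_space_uniform_measure) simp_all

context honeywords
begin

text \<open>At fixed coins the attacker is a measurable function of the lists. Optimality is shown
  for every value of the coins separately.\<close>

lemma valid_attackerD:
  assumes A: "valid_attacker Q U k A" and j: "j < U"
  shows "(\<lambda>L. fst (A r L) j) \<in> listsM {..<U} \<rightarrow>\<^sub>M count_space UNIV"
    and "(\<lambda>L. snd (A r L) j) \<in> listsM {..<U} \<rightarrow>\<^sub>M Q"
proof -
  have r: "(\<lambda>L. (r, L)) \<in> listsM {..<U} \<rightarrow>\<^sub>M seed_space \<Otimes>\<^sub>M listsM {..<U}"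
    by (rule measurable_Pair1') simp
  have "(\<lambda>(r, L). fst (A r L) j) \<in> seed_space \<Otimes>\<^sub>M listsM {..<U} \<rightarrow>\<^sub>M count_space UNIV"
    and "(\<lambda>(r, L). snd (A r L) j) \<in> seed_space \<Otimes>\<^sub>M listsM {..<U} \<rightarrow>\<^sub>M Q"
    using A j by (simp_all add: valid_attacker_def lists_space_def)
  from this[THEN measurable_compose[OF r]]
  show "(\<lambda>L. fst (A r L) j) \<in> listsM {..<U} \<rightarrow>\<^sub>M count_space UNIV"
    and "(\<lambda>L. snd (A r L) j) \<in> listsM {..<U} \<rightarrow>\<^sub>M Q"
    by simp_all
qed

lemma nn_integral_game_output:
  assumes A: "valid_attacker Q U k A"
  shows "(\<integral>\<^sup>+ \<omega>. of_nat (game_output U k t A r \<omega>) \<partial>users {..<U}) =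
    (\<integral>\<^sup>+ \<omega>. ennreal (let L = lists_on k {..<U} \<omega> in expected_game t
      (map (\<lambda>j. posterior f k (L (fst (A r L) j)) (snd (A r L) j)) [0..<U])) \<partial>users {..<U})"
proof -
  \<comment> \<open>The attacker lists its guesses by position, while posteriors are exchanged user
    by user: \<open>ix i L\<close> is the position where user i is attacked and
    \<open>\<gamma> i L\<close> is the word guessed for that user.\<close>
  define ix where "ix i L = (LEAST j. j < U \<and> fst (A r L) j = i)" for i L
  define \<gamma> where "\<gamma> i L = snd (A r L) (ix i L)" for i L
  have bij: "bij_betw (fst (A r L)) {..<U} {..<U}" for L
    using A by (simp add: valid_attacker_def)
  have ix: "ix (fst (A r L) j) L = j" if "j < U" for j L
    unfolding ix_def using bij[of L] that by (intro Least_equality) (auto simp: bij_betw_def inj_on_def)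
  have ix_less: "ix i L < U" if "i < U" for i L
  proof -
    have "i \<in> fst (A r L) ` {..<U}"
      using bij[of L] that by (simp add: bij_betw_def)
    then show ?thesis
      using ix by auto
  qed
  have \<gamma>_meas: "\<gamma> i \<in> listsM {..<U} \<rightarrow>\<^sub>M Q" if i: "i < U" for i
    unfolding \<gamma>_def[abs_def]
  proof (rule measurable_compose_bounded[where f = "\<lambda>j L. snd (A r L) j" and g = "ix i" and n = U])
    have "Measurable.pred (listsM {..<U}) (\<lambda>L. j < U \<and> fst (A r L) j = i)" for j
    proof (cases "j < U")
      case True
      then have eq: "(\<lambda>L. j < U \<and> fst (A r L) j = i) = (\<lambda>L. fst (A r L) j = i)"
        by simp
      show ?thesis
        unfolding eq by (rule measurable_compose[OF valid_attackerD(1)[OF A True] measurable_count_space])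
    next
      case False
      then have eq: "(\<lambda>L. j < U \<and> fst (A r L) j = i) = (\<lambda>L. False)"
        by simp
      show ?thesis
        unfolding eq by (rule measurable_const) simp
    qed
    then show "ix i \<in> listsM {..<U} \<rightarrow>\<^sub>M count_space UNIV"
      unfolding ix_def[abs_def] by (rule measurable_Least)
  qed (rule valid_attackerD(2)[OF A] ix_less[OF i]; assumption)+
  note eq = nn_integral_game_posterior[where \<pi> = "\<lambda>j L. fst (A r L) j" and U = U and t = t and \<gamma> = \<gamma>,
      OF valid_attackerD(1)[OF A] bij \<gamma>_meas, simplified]
  have less: "fst (A r L) j < U" if "j < U" for L j
    using bij[of L] that by (auto simp: bij_betw_def)
  have output_eq: "of_nat (game_output U k t A r \<omega>) = ennreal (expected_game t
      (map ((\<lambda>i. of_bool (\<gamma> i (lists_on k {..<U} \<omega>) = passwords_on {..<U} \<omega> i)) \<circ> fst (A r (lists_on k {..<U} \<omega>))) [0..<U]))"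
      (is "_ = ennreal (expected_game t (map ?b _))") for \<omega>
  proof -
    have "map ?b [0..<U] = map of_bool (map (\<lambda>j. snd (A r (lists_on k {..<U} \<omega>)) j =
        real_pw (\<omega> (fst (A r (lists_on k {..<U} \<omega>)) j))) [0..<U])"
      by (auto simp: \<gamma>_def ix passwords_on_def less)
    then show ?thesis
      by (simp only: expected_game_of_bool game_output_def Let_def lists_on_def[symmetric]
          ennreal_of_nat_eq_real_of_nat)
  qed
  have post_eq: "map ((\<lambda>i. if i < U then posterior f k (L i) (\<gamma> i L) else b i) \<circ> fst (A r L)) [0..<U] =
      map (\<lambda>j. posterior f k (L (fst (A r L) j)) (snd (A r L) j)) [0..<U]" for L b
    by (auto simp: \<gamma>_def ix less)
  show ?thesis
    using eq by (simp only: Let_def output_eq post_eq)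
qed

lemma measurable_best_prob_nth:
  "i < U \<Longrightarrow> (\<lambda>L. best_prob f k (L i)) \<in> borel_measurable (listsM {..<U})"
  by (intro measurable_compose[OF _ measurable_best_prob] measurable_component_singleton) simp

lemma valid_optimal_attacker: "valid_attacker Q U k (optimal_attacker f U k)"
proof -
  let ?\<pi> = "\<lambda>L. descending U (\<lambda>i. best_prob f k (L i))"
  have 1: "(\<lambda>L. ?\<pi> L j) \<in> listsM {..<U} \<rightarrow>\<^sub>M count_space UNIV" for j
    by (rule measurable_descending) (rule measurable_best_prob_nth)
  have 2: "(\<lambda>L. best_guess f k (L (?\<pi> L j))) \<in> listsM {..<U} \<rightarrow>\<^sub>M Q" if j: "j < U" for j
  proof (rule measurable_compose_bounded[where f = "\<lambda>i L. best_guess f k (L i)" and n = U, OF _ 1])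
    show "(\<lambda>L. best_guess f k (L i)) \<in> listsM {..<U} \<rightarrow>\<^sub>M Q" if "i < U" for i
      by (intro measurable_compose[OF _ measurable_best_guess] measurable_component_singleton) (simp add: that)
  qed (rule descending_less[OF j])
  show ?thesis
    unfolding valid_attacker_def optimal_attacker_def Let_def lists_space_def fst_conv snd_conv case_prod_beta
    using measurable_compose[OF measurable_snd 1] measurable_compose[OF measurable_snd 2] bij_descending
    by blast
qed

text \<open>The comparison holds pointwise in the lists, outside the null event of a repeated word.
  As \<open>r\<close> and \<open>r'\<close> are unrelated, no choice of coins can beat the fixed
  strategy, and so neither can an average over coins.\<close>

lemma game_output_le_optimal:
  assumes A: "valid_attacker Q U k A"
  shows "(\<integral>\<^sup>+ \<omega>. of_nat (game_output U k t A r \<omega>) \<partial>users {..<U}) \<le>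
    (\<integral>\<^sup>+ \<omega>. of_nat (game_output U k t (optimal_attacker f U k) r' \<omega>) \<partial>users {..<U})"
  unfolding nn_integral_game_output[OF A] nn_integral_game_output[OF valid_optimal_attacker] Let_def
proof (rule nn_integral_mono_AE)
  have "AE \<omega> in users {..<U}. \<forall>i\<in>{..<U}. inj_on (sweetwords k (\<omega> i)) {..<k}"
    by (intro AE_finite_allI finite_lessThan
        AE_PiM_component[where P = "\<lambda>u. inj_on (sweetwords k u) {..<k}"] AE_sweetwords_inj M.prob_space_axioms)
  then show "AE \<omega> in users {..<U}. ennreal (expected_game t
        (map (\<lambda>j. posterior f k (lists_on k {..<U} \<omega> (fst (A r (lists_on k {..<U} \<omega>)) j))
          (snd (A r (lists_on k {..<U} \<omega>)) j)) [0..<U]))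
    \<le> ennreal (expected_game t
        (map (\<lambda>j. posterior f k (lists_on k {..<U} \<omega> (fst (optimal_attacker f U k r' (lists_on k {..<U} \<omega>)) j))
          (snd (optimal_attacker f U k r' (lists_on k {..<U} \<omega>)) j)) [0..<U]))"
  proof eventually_elim
    case (elim \<omega>)
    define L where "L = lists_on k {..<U} \<omega>"
    define w where "w i = best_prob f k (L i)" for i
    define \<pi> where "\<pi> = fst (A r L)"
    have inj: "inj_on (L i) {..<k}" if "i < U" for i
      using elim that by (simp add: L_def lists_on_def)
    have bij: "bij_betw \<pi> {..<U} {..<U}"
      using A by (simp add: valid_attacker_def \<pi>_def)
    have mset_bij: "mset (map \<rho> [0..<U]) = mset [0..<U]" if "bij_betw \<rho> {..<U} {..<U}" for \<rho>
      using that by (simp add: bij_betw_def atLeast0LessThan image_mset_mset_set)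
    have "expected_game t (map (\<lambda>j. posterior f k (L (\<pi> j)) (snd (A r L) j)) [0..<U]) \<le>
        expected_game t (map (\<lambda>j. w (\<pi> j)) [0..<U])"
      using bij_betwE[OF bij] by (intro expected_game_mono)
        (auto simp: w_def posterior_nonneg best_prob_le_1 intro!: posterior_le_best_prob inj)
    also have "\<dots> \<le> expected_game t (map (\<lambda>j. w (descending U w j)) [0..<U])"
    proof (rule expected_game_le_sorted)
      have "mset (map w (map \<pi> [0..<U])) = mset (map w (map (descending U w) [0..<U]))"
        by (simp only: mset_map[of w] mset_bij[OF bij] mset_bij[OF bij_descending])
      then show "mset (map (\<lambda>j. w (\<pi> j)) [0..<U]) = mset (map (\<lambda>j. w (descending U w j)) [0..<U])"
        by (simp add: o_def)
      show "set (map (\<lambda>j. w (\<pi> j)) [0..<U]) \<subseteq> {0..1}"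
        by (auto simp: w_def best_prob_nonneg best_prob_le_1)
    qed (rule sorted_descending)
    also have "map (\<lambda>j. w (descending U w j)) [0..<U] = map (\<lambda>j. posterior f k
        (L (fst (optimal_attacker f U k r' L) j)) (snd (optimal_attacker f U k r' L) j)) [0..<U]"
      by (auto simp: optimal_attacker_def Let_def w_def[symmetric, abs_def] posterior_best_guess inj descending_less)
    finally show ?case
      unfolding L_def[symmetric] \<pi>_def[symmetric] by (rule ennreal_leI)
  qed
qed

theorem success_number_eq_optimal:
  "success_number P Q k U t =
    (\<integral>\<^sup>+ \<omega>. of_nat (game_output U k t (optimal_attacker f U k) 0 \<omega>) \<partial>users {..<U})" (is "_ = ?V")
proof -
  interpret seed: prob_space seed_space
    by (rule prob_space_seed)
  have const: "(\<integral>\<^sup>+ r. ?V \<partial>seed_space) = ?V"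
    using seed.emeasure_space_1 by (simp add: nn_integral_const)
  show ?thesis
    unfolding success_number_def
  proof (rule antisym)
    have "(\<integral>\<^sup>+ r. \<integral>\<^sup>+ \<omega>. of_nat (game_output U k t A r \<omega>) \<partial>users {..<U} \<partial>seed_space) \<le> ?V"
      if "valid_attacker Q U k A" for A
    proof -
      have "(\<integral>\<^sup>+ r. \<integral>\<^sup>+ \<omega>. of_nat (game_output U k t A r \<omega>) \<partial>users {..<U} \<partial>seed_space) \<le>
          (\<integral>\<^sup>+ r. ?V \<partial>seed_space)"
        by (rule nn_integral_mono) (rule game_output_le_optimal[OF that])
      then show ?thesis
        by (simp only: const)
    qed
    then show "(SUP A \<in> {A. valid_attacker Q U k A}. \<integral>\<^sup>+ r. \<integral>\<^sup>+ \<omega>. of_nat (game_output U k t A r \<omega>)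
        \<partial>users {..<U} \<partial>seed_space) \<le> ?V"
      by (intro SUP_least) simp
    have indep: "game_output U k t (optimal_attacker f U k) r = game_output U k t (optimal_attacker f U k) 0" for r
      by (simp add: game_output_def optimal_attacker_def fun_eq_iff)
    have "?V = (\<integral>\<^sup>+ r. \<integral>\<^sup>+ \<omega>. of_nat (game_output U k t (optimal_attacker f U k) r \<omega>)
        \<partial>users {..<U} \<partial>seed_space)"
      by (subst indep) (rule const[symmetric])
    also have "\<dots> \<le> (SUP A \<in> {A. valid_attacker Q U k A}. \<integral>\<^sup>+ r. \<integral>\<^sup>+ \<omega>. of_nat (game_output U k t A r \<omega>)
        \<partial>users {..<U} \<partial>seed_space)"
      by (rule SUP_upper) (simp add: valid_optimal_attacker)
    finally show "?V \<le> (SUP A \<in> {A. valid_attacker Q U k A}. \<integral>\<^sup>+ r. \<integral>\<^sup>+ \<omega>. of_nat (game_output U k t A r \<omega>)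
        \<partial>users {..<U} \<partial>seed_space)" .
  qed
qed

text \<open>No user is ahead of itself, so \<open>u\<close> can be left out of the count. The count
  then involves \<open>u\<close> only through its score, and the remaining users can be integrated
  out with that score held fixed.\<close>

lemma game_output_optimal:
  defines "s \<equiv> \<lambda>u. best_prob f k (sweetwords k u)"
    and "b \<equiv> \<lambda>u. best_guess f k (sweetwords k u) = real_pw u"
  shows "game_output U k t (optimal_attacker f U k) r \<omega> = (\<Sum>u<U. of_bool (b (\<omega> u) \<and>
    card {v \<in> {..<U} - {u}. ahead (\<lambda>i. s (\<omega> i)) v u \<and> \<not> b (\<omega> v)} < t))"
proof -
  define L where "L = lists_on k {..<U} \<omega>"
  define w where "w i = best_prob f k (L i)" for i
  let ?b = "\<lambda>i. best_guess f k (L i) = real_pw (\<omega> i)"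
  have "game_output U k t (optimal_attacker f U k) r \<omega> =
      game t (map (\<lambda>j. ?b (descending U w j)) [0..<U])"
    by (simp add: game_output_def optimal_attacker_def Let_def L_def w_def[abs_def] lists_on_def[symmetric])
  also have "\<dots> = (\<Sum>u<U. of_bool (?b u \<and> card {v. v < U \<and> ahead w v u \<and> \<not> ?b v} < t))"
    by (rule game_descending)
  also have "\<dots> = (\<Sum>u<U. of_bool (b (\<omega> u) \<and>
      card {v \<in> {..<U} - {u}. ahead (\<lambda>i. s (\<omega> i)) v u \<and> \<not> b (\<omega> v)} < t))"
  proof (rule sum.cong)
    fix u assume u: "u \<in> {..<U}"
    have "{v. v < U \<and> ahead w v u \<and> \<not> ?b v} =
        {v \<in> {..<U} - {u}. ahead (\<lambda>i. s (\<omega> i)) v u \<and> \<not> b (\<omega> v)}"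
      using u by (auto simp: ahead_def w_def L_def lists_on_def s_def b_def)
    then show "of_bool (?b u \<and> card {v. v < U \<and> ahead w v u \<and> \<not> ?b v} < t) =
        (of_bool (b (\<omega> u) \<and>
          card {v \<in> {..<U} - {u}. ahead (\<lambda>i. s (\<omega> i)) v u \<and> \<not> b (\<omega> v)} < t) :: nat)"
      using u by (simp add: L_def lists_on_def b_def)
  qed simp
  finally show ?thesis .
qed

end

section \<open>Counting failures\<close>

lemma sum_subsets_by_card:
  assumes "finite J"
  shows "(\<Sum>B | B \<subseteq> J \<and> card B < t. g (card B)) = (\<Sum>j<t. real (card J choose j) * g j)"
proof -
  have "(\<Sum>B | B \<subseteq> J \<and> card B < t. g (card B)) =
      (\<Sum>j<t. \<Sum>B | B \<in> {B. B \<subseteq> J \<and> card B < t} \<and> card B = j. g (card B))"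
    using assms by (intro sum.group[symmetric]) auto
  also have "\<dots> = (\<Sum>j<t. \<Sum>B | B \<subseteq> J \<and> card B = j. g j)"
    by (intro sum.cong) auto
  also have "\<dots> = (\<Sum>j<t. real (card J choose j) * g j)"
    using assms by (simp add: n_subsets)
  finally show ?thesis .
qed

text \<open>The event splits into disjoint boxes, one for each set of indices at which
  \<open>E\<close> occurs. \<open>E\<close> may vary with the index although its probability may
  not: tie-breaking yields different events of equal probability for different users.\<close>

lemma (in prob_space) binomial_count:
  fixes E :: "nat \<Rightarrow> 'a \<Rightarrow> bool"
  assumes J: "finite J" and E: "\<And>v. v \<in> J \<Longrightarrow> {x \<in> space M. E v x} \<in> events"
    and c: "\<And>v. v \<in> J \<Longrightarrow> prob {x \<in> space M. E v x} = c"
  shows "(\<integral>\<^sup>+ \<omega>. of_bool (card {v \<in> J. E v (\<omega> v)} < t) \<partial>PiM J (\<lambda>_. M)) =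
    ennreal (\<Sum>j<t. real (card J choose j) * c ^ j * (1 - c) ^ (card J - j))"
proof -
  interpret PM: product_sigma_finite "\<lambda>_::nat. M" ..
  define X where "X v = {x \<in> space M. E v x}" for v
  define box where "box B = Pi\<^sub>E J (\<lambda>v. if v \<in> B then X v else space M - X v)" for B
  let ?BB = "{B. B \<subseteq> J \<and> card B < t}"
  have fin: "finite ?BB"
    using J by auto
  have X: "X v \<in> events" if "v \<in> J" for v
    using E[OF that] by (simp add: X_def)
  have box_sets: "box B \<in> sets (PiM J (\<lambda>_. M))" for B
    unfolding box_def using J X by (intro sets_PiM_I_finite) auto
  have emeasure_box: "emeasure (PiM J (\<lambda>_. M)) (box B) = ennreal (c ^ card B * (1 - c) ^ (card J - card B))"
    if B: "B \<subseteq> J" for B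
  proof -
    have "emeasure (PiM J (\<lambda>_. M)) (box B) = (\<Prod>v\<in>J. emeasure M (if v \<in> B then X v else space M - X v))"
      unfolding box_def using J X by (intro PM.emeasure_PiM) auto
    also have "\<dots> = (\<Prod>v\<in>J. ennreal (if v \<in> B then c else 1 - c))"
    proof (rule prod.cong)
      fix v assume v: "v \<in> J"
      have "emeasure M (X v) = ennreal c" "emeasure M (space M - X v) = ennreal (1 - c)"
        using c[OF v] prob_compl[OF X[OF v]] by (simp_all add: emeasure_eq_measure X_def)
      then show "emeasure M (if v \<in> B then X v else space M - X v) = ennreal (if v \<in> B then c else 1 - c)"
        by simp
    qed simp
    also have "\<dots> = ennreal (\<Prod>v\<in>J. if v \<in> B then c else 1 - c)"
    proof (rule prod_ennreal)
      fix v assume "v \<in> J"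
      then have "0 \<le> c" "c \<le> 1"
        using c[of v] by (auto intro: order_trans[OF _ prob_le_1] simp flip: c)
      then show "0 \<le> (if v \<in> B then c else 1 - c)"
        by simp
    qed
    also have "(\<Prod>v\<in>J. if v \<in> B then c else 1 - c) = c ^ card B * (1 - c) ^ (card J - card B)"
      using J B by (subst prod.If_cases)
        (auto simp: Int_absorb1 card_Diff_subset finite_subset Diff_eq[symmetric])
    finally show ?thesis .
  qed
  have disj: "disjoint_family_on box ?BB"
    unfolding disjoint_family_on_def
  proof (intro ballI impI)
    fix B B' assume B: "B \<in> ?BB" "B' \<in> ?BB" "B \<noteq> B'"
    then obtain v where v: "v \<in> J" "v \<in> B \<longleftrightarrow> v \<notin> B'"
      by blast
    show "box B \<inter> box B' = {}"
    proof (rule equals0I)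
      fix \<omega> assume "\<omega> \<in> box B \<inter> box B'"
      then have "\<omega> v \<in> (if v \<in> B then X v else space M - X v)"
        "\<omega> v \<in> (if v \<in> B' then X v else space M - X v)"
        unfolding box_def using v(1) by (blast intro: PiE_mem)+
      then show False
        using v(2) by (auto split: if_splits)
    qed
  qed
  have set_eq: "\<omega> \<in> (\<Union>B\<in>?BB. box B) \<longleftrightarrow> card {v \<in> J. E v (\<omega> v)} < t"
    if \<omega>: "\<omega> \<in> space (PiM J (\<lambda>_. M))" for \<omega>
  proof -
    have "\<omega> \<in> box B \<longleftrightarrow> B = {v \<in> J. E v (\<omega> v)}" if "B \<subseteq> J" for B
      using \<omega> that by (auto simp: box_def X_def space_PiM PiE_iff split: if_splits)
    then show ?thesis
      by auto
  qed
  have "(\<integral>\<^sup>+ \<omega>. of_bool (card {v \<in> J. E v (\<omega> v)} < t) \<partial>PiM J (\<lambda>_. M)) =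
      (\<integral>\<^sup>+ \<omega>. indicator (\<Union>B\<in>?BB. box B) \<omega> \<partial>PiM J (\<lambda>_. M))"
    using set_eq by (intro nn_integral_cong) (simp only: indicator_def)
  also have "\<dots> = emeasure (PiM J (\<lambda>_. M)) (\<Union>B\<in>?BB. box B)"
    using fin box_sets by (intro nn_integral_indicator sets.finite_UN) auto
  also have "\<dots> = (\<Sum>B\<in>?BB. emeasure (PiM J (\<lambda>_. M)) (box B))"
    using box_sets fin disj by (intro sum_emeasure[symmetric]) auto
  also have "\<dots> = (\<Sum>B\<in>?BB. ennreal (c ^ card B * (1 - c) ^ (card J - card B)))"
    by (intro sum.cong refl emeasure_box) simp
  also have "\<dots> = ennreal (\<Sum>B\<in>?BB. c ^ card B * (1 - c) ^ (card J - card B))"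
  \<comment> \<open>For empty \<open>J\<close> nothing confines \<open>c\<close> to [0,1]; then
    \<open>B\<close> can only be empty and both exponents are 0.\<close>
  proof (cases "J = {}")
    case True
    then show ?thesis
      by (intro sum_ennreal) (auto simp: subset_empty)
  next
    case False
    then obtain v where "v \<in> J"
      by auto
    then have "0 \<le> c" "c \<le> 1"
      using c[of v] by (auto intro: order_trans[OF _ prob_le_1] simp flip: c)
    then show ?thesis
      by (intro sum_ennreal) simp
  qed
  also have "(\<Sum>B\<in>?BB. c ^ card B * (1 - c) ^ (card J - card B)) =
      (\<Sum>j<t. real (card J choose j) * c ^ j * (1 - c) ^ (card J - j))"
    using sum_subsets_by_card[OF J, of "\<lambda>j. c ^ j * (1 - c) ^ (card J - j)" t] by (simp add: mult.assoc)
  finally show ?thesis .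
qed

context honeywords
begin

text \<open>Given the list, the best guess is right with probability w, so the case distinction may
  be replaced by the average with weights w and 1 - w. The functions \<open>\<alpha>\<close> and
  \<open>\<beta>\<close> are the payoffs after a right and a wrong guess.\<close>

lemma nn_integral_best_guess:
  fixes \<alpha> \<beta> :: "real \<Rightarrow> ennreal"
  defines "s \<equiv> \<lambda>u. best_prob f k (sweetwords k u)"
    and "b \<equiv> \<lambda>u. best_guess f k (sweetwords k u) = real_pw u"
  assumes \<alpha>: "\<alpha> \<in> borel_measurable borel" and \<beta>: "\<beta> \<in> borel_measurable borel"
  shows "(\<integral>\<^sup>+ u. (if b u then \<alpha> (s u) else \<beta> (s u)) \<partial>M) =
    (\<integral>\<^sup>+ u. (ennreal (s u) * \<alpha> (s u) + ennreal (1 - s u) * \<beta> (s u)) \<partial>M)"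
proof -
  let ?w = "best_prob f k" and ?g = "best_guess f k"
  let ?q = "\<lambda>l. posterior f k l (?g l)"
  let ?F = "\<lambda>z. if ?g (fst z) = snd z then \<alpha> (?w (fst z)) else \<beta> (?w (fst z))"
  \<comment> \<open>\<open>?F'\<close> ignores the password, hence can be taken out of the sum over
    positions and fed back into \<open>nn_integral_user\<close>. It uses the posterior of the best
    guess, which agrees with w once the words are distinct.\<close>
  let ?F' = "\<lambda>z::(nat \<Rightarrow> 'a) \<times> 'a. ennreal (?q (fst z)) * \<alpha> (?w (fst z)) + ennreal (1 - ?q (fst z)) * \<beta> (?w (fst z))"
  have w: "(\<lambda>z. ?w (fst z)) \<in> borel_measurable (Qk \<Otimes>\<^sub>M Q)"
    by (rule measurable_compose[OF measurable_fst measurable_best_prob])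
  have g: "(\<lambda>z. ?g (fst z)) \<in> Qk \<Otimes>\<^sub>M Q \<rightarrow>\<^sub>M Q"
    by (rule measurable_compose[OF measurable_fst measurable_best_guess])
  have q: "(\<lambda>z. ?q (fst z)) \<in> borel_measurable (Qk \<Otimes>\<^sub>M Q)"
    by (rule measurable_posterior[OF measurable_fst g])
  note [measurable] = w q \<alpha> \<beta>
  have "?F \<in> borel_measurable (Qk \<Otimes>\<^sub>M Q)"
    by (intro measurable_If measurable_compose[OF w] \<alpha> \<beta> pred_eq[OF g measurable_snd, unfolded pred_def])
  from nn_integral_user[OF this]
  have "(\<integral>\<^sup>+ u. (if b u then \<alpha> (s u) else \<beta> (s u)) \<partial>M) =
      (\<integral>\<^sup>+ l. (\<Sum>m<k. ennreal (f (l m) / k) * ?F (l, l m)) \<partial>Qk)"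
    by (simp add: s_def b_def cong: if_cong)
  also have "\<dots> = (\<integral>\<^sup>+ l. (\<Sum>m<k. ennreal (f (l m) / k) * ?F' (l, l m)) \<partial>Qk)"
  proof (rule nn_integral_cong)
    fix l
    let ?S = "\<Sum>j<k. f (l j)" and ?A = "\<Sum>m<k. f (l m) * of_bool (l m = ?g l)"
    have S: "?S * ?q l = ?A"
    proof (cases "?S = 0")
      case True
      then have "f (l m) = 0" if "m < k" for m
        using that by (simp add: sum_nonneg_eq_0_iff)
      then show ?thesis
        by simp
    qed (simp add: posterior_def)
    have q01: "0 \<le> ?q l" "?q l \<le> 1"
      by (rule posterior_nonneg posterior_le_1)+
    have "(\<Sum>m<k. ennreal (f (l m) / k) * ?F (l, l m)) =
        (\<Sum>m<k. ennreal (f (l m) * of_bool (l m = ?g l) / k) * \<alpha> (?w l) +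
          ennreal ((f (l m) - f (l m) * of_bool (l m = ?g l)) / k) * \<beta> (?w l))"
      by (intro sum.cong) auto
    also have "\<dots> = ennreal (?A / k) * \<alpha> (?w l) + ennreal ((?S - ?A) / k) * \<beta> (?w l)"
      by (simp only: sum.distrib sum_distrib_right[symmetric] sum_subtractf[symmetric] sum_divide_distrib)
        (subst (1 2) sum_ennreal, auto)
    also have "\<dots> = ennreal (?S / k) * ?F' (l, undefined)"
    proof -
      have "ennreal (?A / k) = ennreal (?S / k) * ennreal (?q l)"
        unfolding S[symmetric] using sum_f_nonneg[of l] q01 by (simp add: ennreal_mult[symmetric])
      moreover have "ennreal ((?S - ?A) / k) = ennreal (?S / k) * ennreal (1 - ?q l)"
        unfolding S[symmetric] using sum_f_nonneg[of l] q01
        by (simp add: ennreal_mult[symmetric] right_diff_distrib diff_divide_distrib)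
      ultimately show ?thesis
        by (simp add: distrib_left mult.assoc)
    qed
    also have "\<dots> = (\<Sum>m<k. ennreal (f (l m) / k) * ?F' (l, l m))"
    proof -
      have "ennreal (?S / k) = (\<Sum>m<k. ennreal (f (l m) / k))"
        by (simp add: sum_divide_distrib sum_ennreal)
      then show ?thesis
        by (simp only: fst_conv sum_distrib_right)
    qed
    finally show "(\<Sum>m<k. ennreal (f (l m) / k) * ?F (l, l m)) =
        (\<Sum>m<k. ennreal (f (l m) / k) * ?F' (l, l m))" .
  qed
  also have "\<dots> = (\<integral>\<^sup>+ u. ?F' (sweetwords k u, real_pw u) \<partial>M)"
    by (rule nn_integral_user[symmetric]) measurable
  also have "\<dots> = (\<integral>\<^sup>+ u. (ennreal (s u) * \<alpha> (s u) + ennreal (1 - s u) * \<beta> (s u)) \<partial>M)"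
    using AE_sweetwords_inj
    by (intro nn_integral_cong_AE, eventually_elim) (simp add: s_def posterior_best_guess)
  finally show ?thesis .
qed

end

section \<open>Integrating over the best guess probability\<close>

locale honeywords_density = honeywords +
  fixes a :: "real \<Rightarrow> real"
  assumes dist: "distributed (user_space P Q k) lborel
      (\<lambda>u. best_prob f k (sweetwords k u)) (\<lambda>t. ennreal (a t))"
    and a_nonneg [simp]: "0 \<le> a t"
begin

text \<open>Probability that a given user is attacked before a user with best guess probability t, and
  that this attack fails.\<close>
definition fail_prob :: "real \<Rightarrow> real" where
  "fail_prob t = (\<integral>x. indicator {t<..} x * ((1 - x) * a x) \<partial>lborel)"

lemma a_meas [measurable]: "a \<in> borel_measurable borel"
  using distributed_real_measurable[OF _ dist] by simp

section \<open>Support and total mass of the density of w\<close>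

lemma nn_integral_best_prob:
  "g \<in> borel_measurable borel \<Longrightarrow>
    (\<integral>\<^sup>+ u. g (best_prob f k (sweetwords k u)) \<partial>M) = (\<integral>\<^sup>+ x. ennreal (a x) * g x \<partial>lborel)"
  using distributed_nn_integral[OF dist, of g] by simp

text \<open>Actual lists almost surely have a nonzero sum of ratios, so w lies in [1/k, 1] and its
  density carries no mass elsewhere. The endpoints are discarded as null sets to match the open
  intervals underlying \<open>LBINT\<close>.\<close>

lemma AE_a_support: "AE x in lborel. a x = 0 \<or> 1 / k < x \<and> x < 1"
proof -
  let ?C = "- {1 / real k..1}"
  have "(\<integral>\<^sup>+ x. ennreal (a x) * indicator ?C x \<partial>lborel) =
      (\<integral>\<^sup>+ u. indicator ?C (best_prob f k (sweetwords k u)) \<partial>M)"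
    by (rule nn_integral_best_prob[symmetric]) simp
  also have "\<dots> = (\<integral>\<^sup>+ u. 0 \<partial>M)"
    using AE_sweetwords_sum
    by (intro nn_integral_cong_AE, eventually_elim)
      (simp add: best_prob_ge_inverse best_prob_le_1)
  finally have "(\<integral>\<^sup>+ x. ennreal (a x) * indicator ?C x \<partial>lborel) = 0"
    by simp
  then have "AE x in lborel. ennreal (a x) * indicator ?C x = 0"
    by (subst (asm) nn_integral_0_iff_AE) simp_all
  moreover have "AE x in lborel. x \<noteq> 1 / real k" "AE x in lborel. x \<noteq> (1::real)"
    by (rule AE_lborel_singleton)+
  ultimately show ?thesis
  proof eventually_elim
    case (elim x)
    then have "a x = 0 \<or> 1 / k \<le> x \<and> x \<le> 1"
      by (simp add: indicator_def split: if_splits)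
    with elim(2,3) show ?case
      by linarith
  qed
qed

lemma nn_integral_a: "(\<integral>\<^sup>+ x. ennreal (a x) \<partial>lborel) = 1"
  using nn_integral_best_prob[of "\<lambda>_. 1"] M.emeasure_space_1 by simp

lemma integrable_a: "integrable lborel a"
  by (rule integrableI_nonneg) (simp_all add: nn_integral_a)

lemma integral_a: "(\<integral>x. a x \<partial>lborel) = 1"
  using nn_integral_eq_integral[OF integrable_a] nn_integral_a by simp

lemma integrable_bounded_mult_a:
  assumes [measurable]: "g \<in> borel_measurable borel"
    and g: "\<And>x. 0 \<le> x \<Longrightarrow> x \<le> 1 \<Longrightarrow> \<bar>g x\<bar> \<le> B"
  shows "integrable lborel (\<lambda>x. g x * a x)"
proof (rule Bochner_Integration.integrable_bound[where f = "\<lambda>x. B * a x"])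
  show "AE x in lborel. norm (g x * a x) \<le> norm (B * a x)"
    using AE_a_support
  proof eventually_elim
    case (elim x)
    have "0 < 1 / real k"
      using k_pos by simp
    then have "a x = 0 \<or> \<bar>g x\<bar> \<le> \<bar>B\<bar>"
      using elim g[of x] by linarith
    then show ?case
    proof
      assume "\<bar>g x\<bar> \<le> \<bar>B\<bar>"
      then show ?thesis
        unfolding real_norm_def abs_mult by (rule mult_right_mono) simp
    qed simp
  qed
qed (use integrable_a in simp_all)

lemma integrable_fail: "integrable lborel (\<lambda>x. indicator {t<..} x * ((1 - x) * a x))"
  using integrable_bounded_mult_a[of "\<lambda>x. indicator {t<..} x * (1 - x)" 1]
  by (simp add: indicator_def mult.assoc)

text \<open>Raising t shrinks the domain of an almost everywhere nonnegative integrand, so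
  \<open>fail_prob\<close> is decreasing and hence Borel.\<close>

lemma fail_prob_meas [measurable]: "fail_prob \<in> borel_measurable borel"
proof -
  have "mono (\<lambda>t. - fail_prob t)"
  proof (rule monoI)
    fix t t' :: real assume "t \<le> t'"
    have "fail_prob t' \<le> fail_prob t"
      unfolding fail_prob_def
    proof (rule integral_mono_AE[OF integrable_fail integrable_fail])
      show "AE x in lborel. indicator {t'<..} x * ((1 - x) * a x) \<le> indicator {t<..} x * ((1 - x) * a x)"
        using AE_a_support
        by eventually_elim (use \<open>t \<le> t'\<close> in \<open>auto simp: indicator_def\<close>)
    qed
    then show "- fail_prob t \<le> - fail_prob t'"
      by simp
  qed
  from borel_measurable_uminus[OF borel_measurable_mono[OF this]] show ?thesis
    by simp
qed

text \<open>\<open>T\<close> is \<open>{t<..}\<close> or \<open>{t..}\<close>, according to how a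
  tie at score t is broken. Having a density, w equals t with probability 0, so both give the same
  value.\<close>

lemma fail_prob_eq:
  assumes "T \<in> sets borel" "T - {t} = {t<..}"
  shows "(\<integral>\<^sup>+ u. of_bool (best_prob f k (sweetwords k u) \<in> T \<and>
      best_guess f k (sweetwords k u) \<noteq> real_pw u) \<partial>M) = ennreal (fail_prob t)"
proof -
  note [measurable] = assms(1)
  have "(\<integral>\<^sup>+ u. of_bool (best_prob f k (sweetwords k u) \<in> T \<and>
      best_guess f k (sweetwords k u) \<noteq> real_pw u) \<partial>M) =
     (\<integral>\<^sup>+ u. (if best_guess f k (sweetwords k u) = real_pw u then (\<lambda>_. 0) (best_prob f k (sweetwords k u))
       else indicator T (best_prob f k (sweetwords k u))) \<partial>M)"
    by (intro nn_integral_cong) (auto simp: indicator_def)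
  also have "\<dots> = (\<integral>\<^sup>+ u. (\<lambda>x. ennreal (1 - x) * indicator T x) (best_prob f k (sweetwords k u)) \<partial>M)"
    by (subst nn_integral_best_guess) simp_all
  also have "\<dots> = (\<integral>\<^sup>+ x. ennreal (a x) * (ennreal (1 - x) * indicator T x) \<partial>lborel)"
    by (rule nn_integral_best_prob) measurable
  also have "\<dots> = (\<integral>\<^sup>+ x. ennreal (indicator {t<..} x * ((1 - x) * a x)) \<partial>lborel)"
    using AE_a_support AE_lborel_singleton[of t]
  proof (intro nn_integral_cong_AE, eventually_elim)
    case (elim x)
    then have "x \<in> T \<longleftrightarrow> t < x"
      using assms(2) by auto
    then show ?case
      using elim by (auto simp: indicator_def ennreal_mult'' mult.commute)
  qed
  also have "\<dots> = ennreal (fail_prob t)"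
    unfolding fail_prob_def
  proof (rule nn_integral_eq_integral[OF integrable_fail])
    show "AE x in lborel. 0 \<le> indicator {t<..} x * ((1 - x) * a x)"
      using AE_a_support by eventually_elim auto
  qed
  finally show ?thesis .
qed

lemma fail_prob_nonneg: "0 \<le> fail_prob t"
  unfolding fail_prob_def
proof (rule integral_nonneg_AE)
  show "AE x in lborel. 0 \<le> indicator {t<..} x * ((1 - x) * a x)"
    using AE_a_support by eventually_elim auto
qed

lemma fail_prob_le_1: "fail_prob t \<le> 1"
proof -
  have "fail_prob t \<le> (\<integral>x. a x \<partial>lborel)"
    unfolding fail_prob_def
  proof (rule integral_mono_AE[OF integrable_fail integrable_a])
    show "AE x in lborel. indicator {t<..} x * ((1 - x) * a x) \<le> a x"
      using AE_a_support
    proof eventually_elim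
      case (elim x)
      have "0 < 1 / real k"
        using k_pos by simp
      then have "a x = 0 \<or> 0 \<le> x"
        using elim by linarith
      then have "0 \<le> x * a x"
        by auto
      then show ?case
        by (auto simp: indicator_def algebra_simps)
    qed
  qed
  then show ?thesis
    by (simp add: integral_a)
qed

text \<open>Up to null sets, subtracting the two integrands from \<open>a\<close> leaves (1 - x)
  a(x) on x > t, and \<open>a\<close> has total mass 1 on (0,1). The bounds on t give both oriented
  integrals the positive direction.\<close>

lemma Ev_eq:
  assumes "0 \<le> t" "t \<le> 1"
  shows "Ev a t = 1 - fail_prob t"
proof -
  have i1: "integrable lborel (\<lambda>x. indicator {0<..<t} x * a x)"
    by (rule integrable_bounded_mult_a[where B = 1]) (auto simp: indicator_def)
  have i2: "integrable lborel (\<lambda>x. indicator {t<..<1} x * x * a x)"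
    by (rule integrable_bounded_mult_a[where B = 1]) (auto simp: indicator_def)
  have e: "einterval (ereal 0) (ereal t) = {0<..<t}" "einterval (ereal t) (ereal 1) = {t<..<1}"
    by (rule einterval_eq)+
  have "Ev a t = (\<integral>x. indicator {0<..<t} x * a x \<partial>lborel) + (\<integral>x. indicator {t<..<1} x * x * a x \<partial>lborel)"
    using assms e by (simp add: Ev_def interval_lebesgue_integral_def set_lebesgue_integral_def
        zero_ereal_def one_ereal_def mult.assoc)
  also have "\<dots> = (\<integral>x. indicator {0<..<t} x * a x + indicator {t<..<1} x * x * a x \<partial>lborel)"
    by (rule Bochner_Integration.integral_add[OF i1 i2, symmetric])
  also have "\<dots> = (\<integral>x. a x - indicator {t<..} x * ((1 - x) * a x) \<partial>lborel)"
  proof (rule integral_cong_AE)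
    show "AE x in lborel. indicator {0<..<t} x * a x + indicator {t<..<1} x * x * a x =
        a x - indicator {t<..} x * ((1 - x) * a x)"
      using AE_a_support AE_lborel_singleton[of t]
    proof eventually_elim
      case (elim x)
      have "0 < 1 / real k"
        using k_pos by simp
      then have "a x = 0 \<or> 0 < x \<and> x < 1"
        using elim by linarith
      then show ?case
        using elim by (auto simp: indicator_def algebra_simps)
    qed
  qed measurable
  also have "\<dots> = 1 - fail_prob t"
    by (simp add: Bochner_Integration.integral_diff[OF integrable_a integrable_fail] integral_a fail_prob_def)
  finally show ?thesis .
qed

text \<open>The lower tail: the probability that a binomial variable with n trials and parameter
  \<open>fail_prob x\<close> stays below t. Its trials count failures of other users.\<close>

definition binomial_tail :: "nat \<Rightarrow> nat \<Rightarrow> real \<Rightarrow> real" where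
  "binomial_tail n t x = (\<Sum>j<t. real (n choose j) * fail_prob x ^ j * (1 - fail_prob x) ^ (n - j))"

section \<open>Expected contribution of a single user\<close>

lemma measurable_best_prob_user [measurable]:
  "(\<lambda>u. best_prob f k (sweetwords k u)) \<in> borel_measurable M"
  by (rule measurable_compose[OF measurable_sweetwords measurable_best_prob])

lemma pred_best_guess_user [measurable]:
  "Measurable.pred M (\<lambda>u. best_guess f k (sweetwords k u) = real_pw u)"
  by (rule pred_eq[OF measurable_compose[OF measurable_sweetwords measurable_best_guess] measurable_real_pw])

lemma measurable_user_contribution:
  defines "s \<equiv> \<lambda>u. best_prob f k (sweetwords k u)"
    and "b \<equiv> \<lambda>u. best_guess f k (sweetwords k u) = real_pw u"
  assumes u: "u < U"
  shows "(\<lambda>\<omega>. of_bool (b (\<omega> u) \<and>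
      card {v \<in> {..<U} - {u}. ahead (\<lambda>i. s (\<omega> i)) v u \<and> \<not> b (\<omega> v)} < t) :: ennreal) \<in> borel_measurable (users {..<U})"
proof -
  let ?J = "{..<U} - {u}"
  note s_meas[measurable] = measurable_best_prob_user[folded s_def]
  note b_meas[measurable] = pred_best_guess_user[folded b_def]
  have comp: "(\<lambda>\<omega>. s (\<omega> v)) \<in> borel_measurable (users {..<U})"
    "Measurable.pred (users {..<U}) (\<lambda>\<omega>. b (\<omega> v))" if "v < U" for v
    using that by (intro measurable_compose[OF _ s_meas] measurable_compose[OF _ b_meas] measurable_component_singleton; simp)+
  have sets: "{\<omega> \<in> space (users {..<U}). v \<in> {v \<in> ?J. ahead (\<lambda>i. s (\<omega> i)) v u \<and> \<not> b (\<omega> v)}} \<in> sets (users {..<U})" for v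
  proof (cases "v \<in> ?J")
    case True
    then have "v < U"
      by simp
    have "Measurable.pred (users {..<U}) (\<lambda>\<omega>. ahead (\<lambda>i. s (\<omega> i)) v u \<and> \<not> b (\<omega> v))"
      by (intro pred_intros_logic(2,3) comp(2) \<open>v < U\<close>
          measurable_ahead[of "\<lambda>\<omega> i. s (\<omega> i)"] comp(1) u)
    then show ?thesis
      using True by (simp add: pred_def)
  next
    case False
    then have "{\<omega> \<in> space (users {..<U}). v \<in> {v \<in> ?J. ahead (\<lambda>i. s (\<omega> i)) v u \<and> \<not> b (\<omega> v)}} = {}"
      by blast
    then show ?thesis
      by (simp only: sets.empty_sets)
  qed
  have "(\<lambda>\<omega>. card {v \<in> ?J. ahead (\<lambda>i. s (\<omega> i)) v u \<and> \<not> b (\<omega> v)}) \<in> users {..<U} \<rightarrow>\<^sub>M count_space UNIV"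
    by (rule measurable_card) (rule sets)
  from measurable_compose[OF this measurable_count_space[of "\<lambda>n. n < t"]]
  have "Measurable.pred (users {..<U}) (\<lambda>\<omega>. b (\<omega> u) \<and>
      card {v \<in> ?J. ahead (\<lambda>i. s (\<omega> i)) v u \<and> \<not> b (\<omega> v)} < t)"
    by (rule pred_intros_logic(3)[OF comp(2)[OF u]])
  then show ?thesis
    unfolding of_bool_def by (intro measurable_If measurable_const) (simp_all only: pred_def space_borel UNIV_I)
qed

text \<open>User \<open>u\<close> is placed in the outer integral. In the inner one its score is a
  constant, so the comparisons with it become independent events of the other users; only afterwards
  is the success of \<open>u\<close> averaged to its score.\<close>

lemma user_contribution:
  defines "s \<equiv> \<lambda>u. best_prob f k (sweetwords k u)"
    and "b \<equiv> \<lambda>u. best_guess f k (sweetwords k u) = real_pw u"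
  assumes u: "u < U"
  shows "(\<integral>\<^sup>+ \<omega>. of_bool (b (\<omega> u) \<and>
      card {v \<in> {..<U} - {u}. ahead (\<lambda>i. s (\<omega> i)) v u \<and> \<not> b (\<omega> v)} < t) \<partial>users {..<U}) =
    (\<integral>\<^sup>+ x. ennreal (a x) * (ennreal x * ennreal (binomial_tail (U - 1) t x)) \<partial>lborel)"
proof -
  let ?J = "{..<U} - {u}"
  \<comment> \<open>The event that user \<open>v\<close> precedes a user u of score
    \<open>\<tau>\<close> and fails; the second disjunct is the tie rule of
    \<open>ahead\<close>.\<close>
  let ?E = "\<lambda>\<tau> v x. (\<tau> < s x \<or> s x = \<tau> \<and> v < u) \<and> \<not> b x"
  have ins: "{..<U} = insert u ?J"
    using u by auto
  note s_meas[measurable] = measurable_best_prob_user[folded s_def]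
  note b_meas[measurable] = pred_best_guess_user[folded b_def]
  have meas: "(\<lambda>\<omega>. of_bool (b (\<omega> u) \<and>
      card {v \<in> ?J. ahead (\<lambda>i. s (\<omega> i)) v u \<and> \<not> b (\<omega> v)} < t) :: ennreal) \<in> borel_measurable (users {..<U})"
    unfolding s_def b_def by (rule measurable_user_contribution[OF u])
  have inner: "(\<integral>\<^sup>+ x. of_bool (card {v \<in> ?J. ?E \<tau> v (x v)} < t) \<partial>users ?J) = ennreal (binomial_tail (U - 1) t \<tau>)" for \<tau>
  proof -
    have sets: "{x \<in> space M. ?E \<tau> v x} \<in> sets M" for v
      by measurable
    have "M.prob {x \<in> space M. ?E \<tau> v x} = fail_prob \<tau>" for v
    proof -
      have "emeasure M {x \<in> space M. ?E \<tau> v x} = (\<integral>\<^sup>+ x. of_bool (s x \<in> {y. \<tau> < y \<or> y = \<tau> \<and> v < u} \<and> \<not> b x) \<partial>M)"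
        unfolding nn_integral_indicator[OF sets, symmetric]
        by (intro nn_integral_cong) (simp add: indicator_def)
      also have "\<dots> = ennreal (fail_prob \<tau>)"
        unfolding s_def b_def
      proof (rule fail_prob_eq)
        have "{y. \<tau> < y \<or> y = \<tau> \<and> v < u} = (if v < u then {\<tau>..} else {\<tau><..})"
          by auto
        then show "{y. \<tau> < y \<or> y = \<tau> \<and> v < u} \<in> sets borel"
          by simp
      qed auto
      finally show ?thesis
        by (simp add: measure_def fail_prob_nonneg)
    qed
    from M.binomial_count[of ?J "?E \<tau>", OF _ sets this]
    show ?thesis
      using u by (simp add: binomial_tail_def)
  qed
  have upd: "of_bool (b ((x(u := y)) u) \<and>
      card {v \<in> ?J. ahead (\<lambda>i. s ((x(u := y)) i)) v u \<and> \<not> b ((x(u := y)) v)} < t) =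
      (if b y then 1 else 0) * (of_bool (card {v \<in> ?J. ?E (s y) v (x v)} < t) :: ennreal)" for x y
  proof -
    have "{v \<in> ?J. ahead (\<lambda>i. s ((x(u := y)) i)) v u \<and> \<not> b ((x(u := y)) v)} = {v \<in> ?J. ?E (s y) v (x v)}"
      by (auto simp: ahead_def)
    then show ?thesis
      by simp
  qed
  have "(\<integral>\<^sup>+ \<omega>. of_bool (b (\<omega> u) \<and>
      card {v \<in> ?J. ahead (\<lambda>i. s (\<omega> i)) v u \<and> \<not> b (\<omega> v)} < t) \<partial>users {..<U}) =
    (\<integral>\<^sup>+ y. \<integral>\<^sup>+ x. of_bool (b ((x(u := y)) u) \<and>
      card {v \<in> ?J. ahead (\<lambda>i. s ((x(u := y)) i)) v u \<and> \<not> b ((x(u := y)) v)} < t) \<partial>users ?J \<partial>M)"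
    by (rule PM.product_nn_integral_insert_rev[of ?J u, folded ins, OF _ _ meas]) simp_all
  also have "\<dots> = (\<integral>\<^sup>+ y. (if b y then ennreal (binomial_tail (U - 1) t (s y)) else (\<lambda>_. 0) (s y)) \<partial>M)"
  proof (rule nn_integral_cong)
    fix y
    show "(\<integral>\<^sup>+ x. of_bool (b ((x(u := y)) u) \<and>
        card {v \<in> ?J. ahead (\<lambda>i. s ((x(u := y)) i)) v u \<and> \<not> b ((x(u := y)) v)} < t) \<partial>users ?J) =
        (if b y then ennreal (binomial_tail (U - 1) t (s y)) else (\<lambda>_. 0) (s y))"
      unfolding upd
    proof (cases "b y")
      case True
      show "(\<integral>\<^sup>+ x. (if b y then 1 else 0) * of_bool (card {v \<in> ?J. ?E (s y) v (x v)} < t) \<partial>users ?J) =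
          (if b y then ennreal (binomial_tail (U - 1) t (s y)) else (\<lambda>_. 0) (s y))"
        by (simp only: True if_True mult_1 inner)
    next
      case False
      then show "(\<integral>\<^sup>+ x. (if b y then 1 else 0) * of_bool (card {v \<in> ?J. ?E (s y) v (x v)} < t) \<partial>users ?J) =
          (if b y then ennreal (binomial_tail (U - 1) t (s y)) else (\<lambda>_. 0) (s y))"
        by simp
    qed
  qed
  also have "\<dots> = (\<integral>\<^sup>+ y. (\<lambda>x. ennreal x * ennreal (binomial_tail (U - 1) t x)) (s y) \<partial>M)"
    unfolding s_def b_def by (subst nn_integral_best_guess) (simp_all add: binomial_tail_def)
  also have "\<dots> = (\<integral>\<^sup>+ x. ennreal (a x) * (ennreal x * ennreal (binomial_tail (U - 1) t x)) \<partial>lborel)"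
    unfolding s_def by (rule nn_integral_best_prob) (simp add: binomial_tail_def)
  finally show ?thesis .
qed

theorem success_number_formula:
  "success_number P Q k U i =
    ennreal (real U * (\<Sum>j = 1..i. LBINT t = 1 / real k..1.
       t * a t * real ((U - 1) choose (j - 1)) * (Ev a t) ^ (U - j) * (1 - Ev a t) ^ (j - 1)))"
proof -
  \<comment> \<open>The integrand of summand j + 1 without its factor \<open>a\<close>, so j is the
    number of failures ahead. The indicator of the open interval absorbs the limits of the interval
    integral.\<close>
  define h where "h j x = indicator {1 / real k<..<1} x *
    (x * (real ((U - 1) choose j) * fail_prob x ^ j * (1 - fail_prob x) ^ (U - 1 - j)))" for j x
  have k01: "0 < 1 / real k" "1 / real k \<le> 1"
    using k_pos by simp_all
  have h_meas: "h j \<in> borel_measurable borel" for j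
    unfolding h_def by measurable
  have h_nonneg: "0 \<le> h j x" for j x
  proof (cases "1 / real k < x \<and> x < 1")
    case True
    then have "0 \<le> x"
      using k01 by linarith
    then show ?thesis
      using fail_prob_nonneg[of x] fail_prob_le_1[of x] by (simp add: h_def indicator_def)
  qed (simp add: h_def)
  have h_bound: "\<bar>h j x\<bar> \<le> real ((U - 1) choose j)" if "0 \<le> x" "x \<le> 1" for j x
  proof -
    have "x * (real ((U - 1) choose j) * fail_prob x ^ j * (1 - fail_prob x) ^ (U - 1 - j)) \<le>
        1 * (real ((U - 1) choose j) * 1 * 1)"
      using that fail_prob_nonneg[of x] fail_prob_le_1[of x]
      by (intro mult_mono power_le_one mult_nonneg_nonneg zero_le_power) simp_all
    then show ?thesis
      using h_nonneg[of j x] by (simp add: h_def indicator_def)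
  qed
  have int: "integrable lborel (\<lambda>x. h j x * a x)" for j
    by (rule integrable_bounded_mult_a[OF h_meas h_bound])
  have ivl: "(LBINT t = 1 / real k..1. t * a t * real ((U - 1) choose (j - 1)) * (Ev a t) ^ (U - j) *
      (1 - Ev a t) ^ (j - 1)) = (\<integral>x. h (j - 1) x * a x \<partial>lborel)" if "1 \<le> j" for j
  proof -
    have e: "einterval (ereal (1 / real k)) (ereal 1) = {1 / real k<..<1}"
      by (rule einterval_eq)
    have Uj: "U - j = U - 1 - (j - 1)"
      using that by simp
    have integrand: "indicator {1 / real k<..<1} x *\<^sub>R (x * a x * real ((U - 1) choose (j - 1)) * (Ev a x) ^ (U - j) *
      (1 - Ev a x) ^ (j - 1)) = h (j - 1) x * a x" for x
    proof (cases "x \<in> {1 / real k<..<1}")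
      case True
      then have "1 / real k < x" "x < 1"
        by auto
      then have "0 \<le> x" "x \<le> 1"
        using k01 by linarith+
      with True show ?thesis
        unfolding Uj by (simp add: h_def Ev_eq)
    qed (simp add: h_def)
    have "ereal (1 / real k) \<le> 1"
      using k01 by (simp add: one_ereal_def)
    then show ?thesis
      unfolding interval_lebesgue_integral_def set_lebesgue_integral_def
      by (simp only: if_True one_ereal_def e integrand)
  qed
  define X where "X = (\<integral>\<^sup>+ x. ennreal (a x) * (ennreal x * ennreal (binomial_tail (U - 1) i x)) \<partial>lborel)"
  have "success_number P Q k U i = of_nat U * X"
    unfolding success_number_eq_optimal game_output_optimal of_nat_sum of_nat_of_bool
  proof (subst nn_integral_sum, goal_cases)
    case (1 u)
    then show ?case
      by (intro measurable_user_contribution) simp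
  next
    case 2
    have "(\<Sum>u<U. \<integral>\<^sup>+ \<omega>. of_bool (best_guess f k (sweetwords k (\<omega> u)) = real_pw (\<omega> u) \<and>
        card {v \<in> {..<U} - {u}. ahead (\<lambda>i. best_prob f k (sweetwords k (\<omega> i))) v u \<and>
          best_guess f k (sweetwords k (\<omega> v)) \<noteq> real_pw (\<omega> v)} < i) \<partial>users {..<U}) = (\<Sum>u<U. X)"
      unfolding X_def by (intro sum.cong refl user_contribution) simp
    then show ?case
      by (simp only: sum_constant card_lessThan)
  qed
  also have "X = (\<integral>\<^sup>+ x. ennreal (\<Sum>j<i. h j x * a x) \<partial>lborel)"
    unfolding X_def using AE_a_support
  proof (intro nn_integral_cong_AE, eventually_elim)
    case (elim x)
    from elim(2) show ?case
    proof
      assume x: "1 / real k < x \<and> x < 1"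
      have "0 \<le> x"
        using x k01 by linarith
      have "(\<Sum>j<i. h j x * a x) = a x * (x * binomial_tail (U - 1) i x)"
        using x by (simp add: h_def binomial_tail_def sum_distrib_left mult.commute)
      moreover have "0 \<le> binomial_tail (U - 1) i x"
        unfolding binomial_tail_def using fail_prob_nonneg[of x] fail_prob_le_1[of x]
        by (intro sum_nonneg) simp
      ultimately show ?thesis
        using \<open>0 \<le> x\<close> by (simp add: ennreal_mult)
    qed simp
  qed
  also have "\<dots> = ennreal (\<Sum>j<i. \<integral>x. h j x * a x \<partial>lborel)"
    using int h_nonneg by (subst nn_integral_eq_integral) (simp_all add: sum_nonneg)
  also have "(\<Sum>j<i. \<integral>x. h j x * a x \<partial>lborel) = (\<Sum>j = 1..i. \<integral>x. h (j - 1) x * a x \<partial>lborel)"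
    by (rule sum.reindex_bij_witness[where i = "\<lambda>j. j - 1" and j = Suc]) auto
  also have "\<dots> = (\<Sum>j = 1..i. LBINT t = 1 / real k..1.
       t * a t * real ((U - 1) choose (j - 1)) * (Ev a t) ^ (U - j) * (1 - Ev a t) ^ (j - 1))"
    by (intro sum.cong refl ivl[symmetric]) simp
  finally show ?thesis
    by (simp add: ennreal_mult' ennreal_of_nat_eq_real_of_nat)
qed

end

text \<open>Without sweetwords the best guess probability would be a constant, which has no density.\<close>
lemma density_imp_sweetwords:
  assumes "prob_space P" "prob_space Q"
    and d: "distributed (user_space P Q k) lborel (\<lambda>u. best_prob f k (sweetwords k u)) g"
  shows "0 < k"
proof (rule ccontr)
  assume "\<not> 0 < k"
  then have k: "k = 0"
    by simp
  interpret P: prob_space P by fact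
  interpret H: prob_space "PiM {..<k - 1} (\<lambda>_::nat. Q)"
    by (rule prob_space_PiM) (rule assms(2))
  interpret S: prob_space "uniform_count_measure {\<sigma>. \<sigma> permutes {..<k}}"
    by (rule prob_space_uniform_count_measure) (auto simp: finite_permutations intro: permutes_id)
  interpret HS: pair_prob_space "PiM {..<k - 1} (\<lambda>_::nat. Q)"
    "uniform_count_measure {\<sigma>. \<sigma> permutes {..<k}}" ..
  interpret PHS: pair_prob_space P
    "PiM {..<k - 1} (\<lambda>_::nat. Q) \<Otimes>\<^sub>M uniform_count_measure {\<sigma>. \<sigma> permutes {..<k}}" ..
  have "emeasure (user_space P Q k) (space (user_space P Q k)) = 1"
    unfolding user_space_def by (rule PHS.emeasure_space_1)
  \<comment> \<open>\<open>Max {}\<close> is an unspecified real. It is the same for every list, so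
    all mass would sit on one point, which is null for \<open>lborel\<close>.\<close>
  define c where "c = (Max {} :: real)"
  have "best_prob f k (sweetwords k u) = c" for u
    by (simp add: best_prob_def k c_def)
  then have "emeasure (user_space P Q k) (space (user_space P Q k)) =
      (\<integral>\<^sup>+ x. g x * indicator {c} x \<partial>lborel)"
    using distributed_emeasure[OF d, of "{c}"] by simp
  also have "\<dots> = (\<integral>\<^sup>+ x. 0 \<partial>(lborel :: real measure))"
    using AE_lborel_singleton[of c] by (intro nn_integral_cong_AE, eventually_elim) simp
  finally show False
    using \<open>emeasure (user_space P Q k) (space (user_space P Q k)) = 1\<close> by simp
qed

theorem theorem4:
  fixes P Q :: "'a measure" and f :: "'a \<Rightarrow> real" and a :: "real \<Rightarrow> real"
    and k U i :: nat
  assumes "prob_space P" and "prob_space Q"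
    and "f \<in> borel_measurable Q" and "\<forall>x. 0 \<le> f x"
    and "P = density Q (\<lambda>x. ennreal (f x))"
    and "\<forall>x\<in>space Q. emeasure Q {x} = 0"
    and "{p \<in> space (Q \<Otimes>\<^sub>M Q). fst p = snd p} \<in> sets (Q \<Otimes>\<^sub>M Q)"
    and "distributed (user_space P Q k) lborel
           (\<lambda>u. best_prob f k (sweetwords k u)) (\<lambda>t. ennreal (a t))"
    and "\<forall>t. 0 \<le> a t"
  shows "success_number P Q k U i =
    ennreal (real U * (\<Sum>j = 1..i. LBINT t = 1 / real k..1.
       t * a t * real ((U - 1) choose (j - 1)) * (Ev a t) ^ (U - j) * (1 - Ev a t) ^ (j - 1)))"
proof -
  \<comment> \<open>Positivity of \<open>k\<close>, demanded by the locale, is extracted from the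
    existence of a density of w.\<close>
  interpret honeywords_density P Q f k a
    by (intro honeywords_density.intro honeywords.intro honeywords_density_axioms.intro)
      (use assms density_imp_sweetwords[OF assms(1,2,8)] in \<open>simp_all only:\<close>)
  show ?thesis
    by (rule success_number_formula)
qed

end
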